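(* Fix $\alpha\in(0,1)$. There exist constants $C_1^*(\alpha),C_2^*(\alpha)$ depending only on $\alpha$ such that the following holds. Let $\beta_{(1)}^2\ge\dots\ge\beta_{(d)}^2$ be the order statistics of $\beta_1^2,\dots,\beta_d^2$, and suppose $k$ is the smallest integer in $\{1,\dots,d\}$ such that $$\frac{2\beta_{(k)}^2}{\sigma^2 b_k(\Sigma)}<-\tfrac12\log\alpha.$$ Then every knockoff procedure at FDR level $\alpha$ (with any diagonal $\Delta\succeq\Sigma$ and any ordering/sign rule, both possibly chosen with full knowledge of $\beta$ and $\sigma^2$) satisfies $\mathbb E R\le C_1^*(\alpha)k+C_2^*(\alpha)$.
   Context: Whitening setup: $\Sigma\in\mathbb R^{d\times d}$ symmetric positive definite, $\beta\in\mathbb R^d$, $\sigma^2>0$, $\widehat\beta\sim\mathcal N_d(\beta,\sigma^2\Sigma)$. A knockoff procedure at level $\alpha$ consists of a diagonal $\Delta\succeq\Sigma$ ($\succeq$ the positive semidefinite order), noise $\omega\sim\mathcal N_d(0,\sigma^2(\Delta-\Sigma))$ independent of $\widehat\beta$, $\widetilde\beta=\widehat\beta+\omega$, $\xi=\Sigma^{-1}\widehat\beta-\Delta^{-1}\widetilde\beta$, and a rule that, as a function of $(\xi,|\widetilde\beta|)$ (and possibly of $\beta,\sigma^2$ and independent auxiliary randomness), outputs an ordering $[1],\dots,[d]$ and signs $\psi_j\in\{\pm1\}$; $\widetilde p_j=1/2$ if $\operatorname{sgn}(\widetilde\beta_j)=\psi_j$, else $1$; $\widehat{\mathrm{FDP}}_k=\frac{1+\#\{j\le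 k:\widetilde p_{[j]}=1\}}{\#\{j\le k:\widetilde p_{[j]}=1/2\}}$; $\hat k=\max\{k:\widehat{\mathrm{FDP}}_k\le\alpha\}$ ($0$ if none); rejections are the $H_{[j]}:\beta_{[j]}=0$, $j\le\hat k$, with $\widetilde p_{[j]}=1/2$; $R$ is their number. For $\Sigma$ with eigenvalues $\lambda_1\ge\dots\ge\lambda_d$ and orthonormal eigenvectors $u_1,\dots,u_d$, and $u_{\ell,(1)}^2\le\dots\le u_{\ell,(d)}^2$ the order statistics of the squared entries of $u_\ell$, define $b_k(\Sigma)=\max_{\ell\le d}\lambda_\ell\sum_{j=1}^k u_{\ell,(j)}^2$. *)

theory Defs
  imports "HOL-Probability.Probability"
begin

text \<open>Finite-dimensional linear algebra on explicit carriers: vectors are functions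
 nat => real, matrices nat => nat => real; only indices < d are meaningful.\<close>

definition mat_vec :: "nat \<Rightarrow> (nat \<Rightarrow> nat \<Rightarrow> real) \<Rightarrow> (nat \<Rightarrow> real) \<Rightarrow> (nat \<Rightarrow> real)" where
  "mat_vec d A x = (\<lambda>i\<in>{..<d}. \<Sum>j<d. A i j * x j)"

definition quad_form :: "nat \<Rightarrow> (nat \<Rightarrow> nat \<Rightarrow> real) \<Rightarrow> (nat \<Rightarrow> real) \<Rightarrow> real" where
  "quad_form d A x = (\<Sum>i<d. \<Sum>j<d. x i * A i j * x j)"

definition sym_mat :: "nat \<Rightarrow> (nat \<Rightarrow> nat \<Rightarrow> real) \<Rightarrow> bool" where
  "sym_mat d A \<longleftrightarrow> (\<forall>i<d. \<forall>j<d. A i j = A j i)"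

definition pos_def :: "nat \<Rightarrow> (nat \<Rightarrow> nat \<Rightarrow> real) \<Rightarrow> bool" where
  "pos_def d A \<longleftrightarrow> sym_mat d A \<and> (\<forall>x. (\<exists>i<d. x i \<noteq> 0) \<longrightarrow> quad_form d A x > 0)"

definition pos_semidef :: "nat \<Rightarrow> (nat \<Rightarrow> nat \<Rightarrow> real) \<Rightarrow> bool" where
  "pos_semidef d A \<longleftrightarrow> sym_mat d A \<and> (\<forall>x. quad_form d A x \<ge> 0)"

definition diag_mat :: "(nat \<Rightarrow> real) \<Rightarrow> (nat \<Rightarrow> nat \<Rightarrow> real)" where
  "diag_mat \<delta> = (\<lambda>i j. if i = j then \<delta> i else 0)"

definition loewner_ge :: "nat \<Rightarrow> (nat \<Rightarrow> nat \<Rightarrow> real) \<Rightarrow> (nat \<Rightarrow> nat \<Rightarrow> real) \<Rightarrow> bool" where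
  "loewner_ge d A B \<longleftrightarrow> pos_semidef d (\<lambda>i j. A i j - B i j)"

definition mat_mult_transp :: "nat \<Rightarrow> (nat \<Rightarrow> nat \<Rightarrow> real) \<Rightarrow> (nat \<Rightarrow> nat \<Rightarrow> real)" where
  "mat_mult_transp d A = (\<lambda>i j. \<Sum>l<d. A i l * A j l)"

definition mat_inv_vec :: "nat \<Rightarrow> (nat \<Rightarrow> nat \<Rightarrow> real) \<Rightarrow> (nat \<Rightarrow> real) \<Rightarrow> (nat \<Rightarrow> real)" where
  "mat_inv_vec d A y = (THE x. x \<in> extensional {..<d} \<and> (\<forall>i<d. (\<Sum>j<d. A i j * x j) = y i))"

definition eigen_decomp :: "nat \<Rightarrow> (nat \<Rightarrow> nat \<Rightarrow> real) \<Rightarrow> (nat \<Rightarrow> real) \<Rightarrow> (nat \<Rightarrow> nat \<Rightarrow> real) \<Rightarrow> bool" where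
  "eigen_decomp d S lam u \<longleftrightarrow>
     (\<forall>l<d. \<forall>i<d. (\<Sum>j<d. S i j * u l j) = lam l * u l i) \<and>
     (\<forall>l<d. \<forall>m<d. (\<Sum>i<d. u l i * u m i) = (if l = m then 1 else 0)) \<and>
     (\<forall>l m. l \<le> m \<longrightarrow> m < d \<longrightarrow> lam m \<le> lam l)"

definition order_stats_inc :: "nat \<Rightarrow> (nat \<Rightarrow> real) \<Rightarrow> real list" where
  "order_stats_inc d f = sort (map f [0..<d])"

definition b_k :: "nat \<Rightarrow> (nat \<Rightarrow> real) \<Rightarrow> (nat \<Rightarrow> nat \<Rightarrow> real) \<Rightarrow> nat \<Rightarrow> real" where
  "b_k d lam u k = Max ((\<lambda>l. lam l * sum_list (take k (order_stats_inc d (\<lambda>i. (u l i)\<^sup>2)))) ` {..<d})"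

definition beta_sq_desc :: "nat \<Rightarrow> (nat \<Rightarrow> real) \<Rightarrow> nat \<Rightarrow> real" where
  "beta_sq_desc d \<beta> k = rev (order_stats_inc d (\<lambda>i. (\<beta> i)\<^sup>2)) ! (k - 1)"

text \<open>The signal-strength condition 2 beta_(k)^2 / (sigma^2 b_k) < -(1/2) log alpha
 (a zero denominator is read as an infinite ratio, so the condition fails).\<close>
definition strength_cond :: "real \<Rightarrow> nat \<Rightarrow> (nat \<Rightarrow> real) \<Rightarrow> real \<Rightarrow> (nat \<Rightarrow> real) \<Rightarrow> (nat \<Rightarrow> nat \<Rightarrow> real) \<Rightarrow> nat \<Rightarrow> bool" where
  "strength_cond \<alpha> d \<beta> \<sigma>2 lam u k \<longleftrightarrow>
     0 < \<sigma>2 * b_k d lam u k \<and> 2 * beta_sq_desc d \<beta> k / (\<sigma>2 * b_k d lam u k) < - (1/2) * ln \<alpha>"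

text \<open>Probability space: z, w independent standard Gaussian vectors in R^d and an
 independent uniform [0,1] variable (auxiliary randomness).\<close>
definition std_gauss :: "nat \<Rightarrow> (nat \<Rightarrow> real) measure" where
  "std_gauss d = (\<Pi>\<^sub>M i\<in>{..<d}. density lborel std_normal_density)"

definition knock_space :: "nat \<Rightarrow> (((nat \<Rightarrow> real) \<times> (nat \<Rightarrow> real)) \<times> real) measure" where
  "knock_space d = (std_gauss d \<Otimes>\<^sub>M std_gauss d) \<Otimes>\<^sub>M uniform_measure lborel {0..1}"

text \<open>A rule maps (xi, |beta tilde|, auxiliary uniform) to (ordering, signs): position j
 (0-based, j < d) of the ordering is the variable perm j, and psi i is the sign of variable i.\<close>
type_synonym rule = "(nat \<Rightarrow> real) \<Rightarrow> (nat \<Rightarrow> real) \<Rightarrow> real \<Rightarrow> (nat \<Rightarrow> nat) \<times> (nat \<Rightarrow> real)"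

definition valid_rule :: "nat \<Rightarrow> rule \<Rightarrow> bool" where
  "valid_rule d r \<longleftrightarrow> (\<forall>x y a. bij_betw (fst (r x y a)) {..<d} {..<d} \<and>
                          (\<forall>i<d. snd (r x y a) i \<in> {-1, 1}))"

text \<open>Given beta tilde and (perm, psi): the rejection count R.
 ptilde_[j] = 1/2 iff sgn(beta tilde_[j]) = psi_[j]. FDP-hat is +infinity when the
 denominator is 0.\<close>
definition half_p :: "(nat \<Rightarrow> real) \<Rightarrow> (nat \<Rightarrow> nat) \<Rightarrow> (nat \<Rightarrow> real) \<Rightarrow> nat \<Rightarrow> bool" where
  "half_p bt perm \<psi> j \<longleftrightarrow> sgn (bt (perm j)) = \<psi> (perm j)"

definition fdp_hat :: "(nat \<Rightarrow> real) \<Rightarrow> (nat \<Rightarrow> nat) \<Rightarrow> (nat \<Rightarrow> real) \<Rightarrow> nat \<Rightarrow> ereal" where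
  "fdp_hat bt perm \<psi> k =
     (let P = card {j. j < k \<and> half_p bt perm \<psi> j};
          N = card {j. j < k \<and> \<not> half_p bt perm \<psi> j}
      in if P = 0 then \<infinity> else ereal ((1 + real N) / real P))"

definition k_hat :: "real \<Rightarrow> nat \<Rightarrow> (nat \<Rightarrow> real) \<Rightarrow> (nat \<Rightarrow> nat) \<Rightarrow> (nat \<Rightarrow> real) \<Rightarrow> nat" where
  "k_hat \<alpha> d bt perm \<psi> =
     (if \<exists>k\<in>{1..d}. fdp_hat bt perm \<psi> k \<le> ereal \<alpha>
      then Max {k\<in>{1..d}. fdp_hat bt perm \<psi> k \<le> ereal \<alpha>} else 0)"

definition n_rej :: "real \<Rightarrow> nat \<Rightarrow> (nat \<Rightarrow> real) \<Rightarrow> (nat \<Rightarrow> nat) \<Rightarrow> (nat \<Rightarrow> real) \<Rightarrow> nat" where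
  "n_rej \<alpha> d bt perm \<psi> = card {j. j < k_hat \<alpha> d bt perm \<psi> \<and> half_p bt perm \<psi> j}"

text \<open>The knockoff procedure as a function of the sample ((z, w), a):
 beta hat = beta + sigma A z (A A^T = Sigma), omega = sigma B w (B B^T = Delta - Sigma),
 beta tilde = beta hat + omega, xi = Sigma^{-1} beta hat - Delta^{-1} beta tilde.\<close>
definition knockoff_R ::
  "real \<Rightarrow> nat \<Rightarrow> (nat \<Rightarrow> nat \<Rightarrow> real) \<Rightarrow> (nat \<Rightarrow> real) \<Rightarrow> real \<Rightarrow> (nat \<Rightarrow> real)
   \<Rightarrow> (nat \<Rightarrow> nat \<Rightarrow> real) \<Rightarrow> (nat \<Rightarrow> nat \<Rightarrow> real) \<Rightarrow> rule
   \<Rightarrow> ((nat \<Rightarrow> real) \<times> (nat \<Rightarrow> real)) \<times> real \<Rightarrow> nat" where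
  "knockoff_R \<alpha> d S \<beta> \<sigma> \<delta> A B r s =
     (let z = fst (fst s); w = snd (fst s); a = snd s;
          bhat = (\<lambda>i\<in>{..<d}. \<beta> i + \<sigma> * mat_vec d A z i);
          bt = (\<lambda>i\<in>{..<d}. bhat i + \<sigma> * mat_vec d B w i);
          xi = (\<lambda>i\<in>{..<d}. mat_inv_vec d S bhat i - bt i / \<delta> i);
          absbt = (\<lambda>i\<in>{..<d}. \<bar>bt i\<bar>);
          (perm, \<psi>) = r xi absbt a
      in n_rej \<alpha> d bt perm \<psi>)"

end

theory Submission
  imports Defs
begin

text \<open>The noisy estimate has independent coordinates and is independent of \<open>\<xi>\<close>, so given
  \<open>\<xi>\<close> and the absolute values the signs are independent, sign \<open>i\<close> having log odds
  \<open>x\<^sub>i = 2 \<beta>\<^sub>i b\<^sub>i / (\<sigma>\<^sup>2 \<delta>\<^sub>i)\<close>, where \<open>b\<close> is the noisy estimate. Call \<open>i\<close> bad if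
  \<open>\<bar>x\<^sub>i\<bar> > - ln \<alpha> / 2\<close>. A rejection set of size \<open>R\<close> needs about \<open>1 / \<alpha>\<close> matches per mismatch, which
  is more than the odds of a good sign, at most \<open>\<alpha> powr (-1/2)\<close>, can sustain: an exponential
  supermartingale-type bound for the walk over the good signs gives \<open>E R \<le> C (1 + E (number of bad indices))\<close>.

  Testing \<open>\<Delta> \<succeq> \<Sigma> \<succeq> \<lambda> u u\<^sup>T\<close> on truncations of the eigenvectors shows that among any \<open>m \<ge> k\<close>
  indices some \<open>\<delta>\<^sub>i\<close> is at least \<open>b\<^sub>k m / k\<close>. Apart from the fewer than \<open>k\<close> indices with
  \<open>\<beta>\<^sub>i\<^sup>2 > \<beta>\<^bsub>(k)\<^esub>\<^sup>2\<close>, a fourth moment bound gives probability \<open>O((b\<^sub>k / \<delta>\<^sub>i)\<^sup>2)\<close> for \<open>i\<close> to be bad, and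
  \<open>\<Sum> min 1 ((b\<^sub>k / \<delta>\<^sub>i)\<^sup>2) \<le> 2 k\<close>.

  The ordering and sign rule need not be measurable, so conditioning is replaced by averaging over
  the reflections of the underlying Gaussian vector that flip the signs of a set of coordinates of
  \<open>b\<close> and fix \<open>\<xi>\<close>.\<close>

subsection \<open>Linear algebra and order statistics\<close>

text \<open>Gaussian elimination: one equation is solved for a pivot unknown \<open>p\<close> and
  substituted into the others, which loses one equation and one unknown.\<close>

lemma nontrivial_kernel:
  fixes a :: "'i \<Rightarrow> 'j \<Rightarrow> 'f::field"
  assumes "finite I" "finite J" "card I < card J"
  shows "\<exists>c. (\<exists>j\<in>J. c j \<noteq> 0) \<and> (\<forall>i\<in>I. (\<Sum>j\<in>J. a i j * c j) = 0)"
  using assms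
proof (induction I arbitrary: J a rule: finite_induct)
  case empty
  then obtain j where "j \<in> J" by fastforce
  then show ?case by (intro exI[of _ "\<lambda>_. 1"]) auto
next
  case (insert i I)
  show ?case
  proof (cases "\<forall>j\<in>J. a i j = 0")
    case True
    have "card I < card J" using insert by simp
    from insert.IH[OF insert.prems(1) this, of a] obtain c where
      c: "\<exists>j\<in>J. c j \<noteq> 0" "\<forall>i\<in>I. (\<Sum>j\<in>J. a i j * c j) = 0" by blast
    moreover have "(\<Sum>j\<in>J. a i j * c j) = 0" using True by (intro sum.neutral) auto
    ultimately show ?thesis by blast
  next
    case False
    then obtain p where p: "p \<in> J" "a i p \<noteq> 0" by blast
    define J' where "J' = J - {p}"
    \<comment> \<open>Row \<open>k\<close> minus the multiple of row \<open>i\<close> that kills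
      column \<open>p\<close>.\<close>
    define a' where "a' k j = a k j - a k p * a i j / a i p" for k j
    have J': "finite J'" "card I < card J'" "p \<notin> J'" "J = insert p J'"
      using insert p by (auto simp: J'_def)
    from insert.IH[OF J'(1,2), of a'] obtain c where
      c: "\<exists>j\<in>J'. c j \<noteq> 0" "\<forall>k\<in>I. (\<Sum>j\<in>J'. a' k j * c j) = 0" by blast
    define c' where "c' = c(p := - (\<Sum>j\<in>J'. a i j * c j) / a i p)"
    have sum: "(\<Sum>j\<in>J. a k j * c' j) = a k p * c' p + (\<Sum>j\<in>J'. a k j * c j)" for k
      using J' by (auto simp: c'_def intro!: sum.cong)
    have "(\<Sum>j\<in>J. a i j * c' j) = 0"
      unfolding sum using p by (simp add: c'_def)
    moreover have "(\<Sum>j\<in>J. a k j * c' j) = 0" if "k \<in> I" for k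
    proof -
      have "(\<Sum>j\<in>J'. a' k j * c j) = (\<Sum>j\<in>J'. a k j * c j) - a k p / a i p * (\<Sum>j\<in>J'. a i j * c j)"
        by (simp add: a'_def algebra_simps sum_subtractf sum_distrib_left)
      then show ?thesis unfolding sum using c(2) that p by (simp add: c'_def)
    qed
    moreover have "\<exists>j\<in>J. c' j \<noteq> 0" using c(1) J' by (auto simp: c'_def)
    ultimately show ?thesis by blast
  qed
qed

lemma quad_form_eq_sum:
  "quad_form d S x = (\<Sum>i<d. x i * (\<Sum>j<d. S i j * x j))"
  by (simp add: quad_form_def sum_distrib_left mult.assoc)

lemma pos_def_kernel:
  assumes "pos_def d S" "\<And>i. i < d \<Longrightarrow> (\<Sum>j<d. S i j * x j) = 0" "j < d"
  shows "x j = 0"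
proof (rule ccontr)
  assume "x j \<noteq> 0"
  then have "quad_form d S x > 0" using assms unfolding pos_def_def by blast
  moreover have "quad_form d S x = 0" using assms(2) by (simp add: quad_form_eq_sum)
  ultimately show False by simp
qed

text \<open>The d equations of the augmented matrix [S | y] in d + 1 unknowns have a nonzero
  solution. Its last entry cannot vanish, because S has trivial kernel, so it can be scaled to
  -1.\<close>

lemma pos_def_solvable:
  assumes "pos_def d S"
  shows "\<exists>x. \<forall>i<d. (\<Sum>j<d. S i j * x j) = y i"
proof -
  define a where "a i j = (if j < d then S i j else y i)" for i j
  have "\<exists>c. (\<exists>j\<in>{..<Suc d}. c j \<noteq> 0) \<and> (\<forall>i\<in>{..<d}. (\<Sum>j\<in>{..<Suc d}. a i j * c j) = 0)"
    by (rule nontrivial_kernel) auto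
  then obtain c where c: "\<exists>j\<in>{..<Suc d}. c j \<noteq> 0" "\<forall>i\<in>{..<d}. (\<Sum>j<Suc d. a i j * c j) = 0"
    by blast
  have eq: "(\<Sum>j<d. S i j * c j) + y i * c d = 0" if "i < d" for i
    using c(2) that by (simp add: a_def)
  have "c d \<noteq> 0"
  proof
    assume cd: "c d = 0"
    have "c j = 0" if "j < d" for j
      by (rule pos_def_kernel[OF assms _ that]) (use eq cd in simp)
    with c(1) cd show False by (auto simp: less_Suc_eq)
  qed
  then have "(\<Sum>j<d. S i j * (- c j / c d)) = y i" if "i < d" for i
    using eq[OF that] by (simp add: sum_negf flip: sum_divide_distrib) (simp add: field_simps)
  then show ?thesis by (intro exI[of _ "\<lambda>j. - c j / c d"]) blast
qed

lemma mat_inv_vec_eqI: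
  assumes "pos_def d S" "x \<in> extensional {..<d}" "\<And>i. i < d \<Longrightarrow> (\<Sum>j<d. S i j * x j) = y i"
  shows "mat_inv_vec d S y = x"
  unfolding mat_inv_vec_def
proof (rule the_equality)
  fix x' assume x': "x' \<in> extensional {..<d} \<and> (\<forall>i<d. (\<Sum>j<d. S i j * x' j) = y i)"
  have "x' j - x j = 0" if "j < d" for j
    by (rule pos_def_kernel[OF assms(1) _ that]) (use x' assms(3) in \<open>simp add: algebra_simps sum_subtractf\<close>)
  with x' assms(2) show "x' = x" by (intro extensionalityI[of _ "{..<d}"]) auto
qed (use assms in auto)

lemma mat_inv_vec_solves:
  assumes "pos_def d S" "i < d"
  shows "(\<Sum>j<d. S i j * mat_inv_vec d S y j) = y i"
proof -
  obtain x where x: "\<forall>i<d. (\<Sum>j<d. S i j * x j) = y i" using pos_def_solvable[OF assms(1)] by blast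
  have "mat_inv_vec d S y = restrict x {..<d}"
    by (rule mat_inv_vec_eqI[OF assms(1)]) (use x in auto)
  then show ?thesis using x assms(2) by simp
qed

text \<open>Used for the invariance of \<open>xi\<close>: a sign flip moves the estimate by a
  combination of columns of S.\<close>

lemma mat_inv_vec_add:
  assumes "pos_def d S" "\<And>i. i < d \<Longrightarrow> y' i = y i + (\<Sum>j<d. S i j * c j)" "i < d"
  shows "mat_inv_vec d S y' i = mat_inv_vec d S y i + c i"
proof -
  have "mat_inv_vec d S y' = (\<lambda>i\<in>{..<d}. mat_inv_vec d S y i + c i)"
    by (rule mat_inv_vec_eqI[OF assms(1)])
      (simp_all add: distrib_left sum.distrib mat_inv_vec_solves[OF assms(1)] assms(2))
  then show ?thesis using assms(3) by simp
qed

section \<open>Sums of smallest entries and order statistics\<close>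

text \<open>The head of the sorted list is matched with an element of \<open>N\<close> that is at
  least as large, both are removed, and the rest follows by induction. Multisets take care of
  ties.\<close>

lemma sum_list_take_sorted_le:
  fixes xs :: "'a::{linorder,ordered_comm_monoid_add} list"
  assumes "sorted xs" "N \<subseteq># mset xs" "size N = k"
  shows "sum_list (take k xs) \<le> sum_mset N"
  using assms
proof (induction xs arbitrary: N k)
  case (Cons x xs)
  show ?case
  proof (cases k)
    case (Suc m)
    \<comment> \<open>Take n = x if x occurs in \<open>N\<close>. Otherwise \<open>N\<close> already
      lies in the tail, and any element of it will do.\<close>
    obtain n where n: "n \<in># N" "x \<le> n" "N - {#n#} \<subseteq># mset xs"
    proof (cases "x \<in># N")
      case True
      then show ?thesis using Cons.prems that[of x] by (simp add: subset_eq_diff_conv)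
    next
      case False
      have "N - {#x#} \<subseteq># mset xs" using Cons.prems(2) by (simp add: subset_eq_diff_conv)
      then have sub: "N \<subseteq># mset xs" using False by (simp add: diff_single_trivial)
      obtain n where "n \<in># N" using Suc Cons.prems(3) by (cases N) auto
      with sub Cons.prems(1) show ?thesis
        by (intro that[of n]) (auto dest: mset_subset_eqD intro: subset_mset.order_trans[OF diff_subset_eq_self])
    qed
    have "sum_list (take m xs) \<le> sum_mset (N - {#n#})"
      by (rule Cons.IH) (use Cons.prems n Suc in \<open>auto simp: size_Diff_singleton\<close>)
    moreover have "sum_mset N = n + sum_mset (N - {#n#})"
      using n(1) by (metis insert_DiffM sum_mset.add_mset)
    ultimately show ?thesis using Suc n(2) by (simp add: add_mono)
  qed (use Cons.prems in auto)
qed auto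

lemma sum_smallest_le_sum:
  assumes "K \<subseteq> {..<d}"
  shows "sum_list (take (card K) (order_stats_inc d f)) \<le> sum f K"
proof -
  have "image_mset f (mset_set K) \<subseteq># mset (order_stats_inc d f)"
  proof -
    have "mset_set K \<subseteq># mset_set {..<d}" using assms by (simp add: subset_imp_msubset_mset_set)
    then have "image_mset f (mset_set K) \<subseteq># image_mset f (mset_set {..<d})" by (rule image_mset_subseteq_mono)
    then show ?thesis by (simp add: order_stats_inc_def lessThan_atLeast0)
  qed
  from sum_list_take_sorted_le[OF _ this, of "card K"] show ?thesis
    by (simp add: order_stats_inc_def sum_unfold_sum_mset)
qed

text \<open>Averaging over the deletion of one element shows that the mean of the \<open>m\<close> smallest entries
  is nondecreasing in \<open>m\<close>.\<close>
lemma mean_smallest_le_mean: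
  assumes "K \<subseteq> {..<d}" "card K = m" "k \<le> m" "1 \<le> k"
  shows "real m * sum_list (take k (order_stats_inc d f)) \<le> real k * sum f K"
  using assms(3,1,2)
proof (induction m arbitrary: K rule: dec_induct)
  case base
  then show ?case using sum_smallest_le_sum[of K d f] by (simp add: mult_left_mono)
next
  case (step m)
  let ?s = "sum_list (take k (order_stats_inc d f))"
  have fin: "finite K" using step.prems finite_subset by blast
  have "(\<Sum>i\<in>K. real m * ?s) \<le> (\<Sum>i\<in>K. real k * sum f (K - {i}))"
    by (intro sum_mono step.IH) (use step.prems in auto)
  also have "\<dots> = (\<Sum>i\<in>K. real k * (sum f K - f i))"
    using fin by (simp add: sum_diff1)
  also have "\<dots> = real k * (real (card K) * sum f K - sum f K)"
    by (simp add: sum_subtractf flip: sum_distrib_left)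
  also have "\<dots> = real m * (real k * sum f K)" using step.prems by (simp add: algebra_simps)
  finally have "real m * (real (Suc m) * ?s) \<le> real m * (real k * sum f K)"
    using step.prems(2) by (simp add: mult.left_commute)
  moreover have "real m > 0" using step.hyps assms(4) by simp
  ultimately show ?case by (simp only: mult_le_cancel_left_pos)
qed

lemma card_beta_sq_gt:
  assumes "1 \<le> k" "k \<le> d"
  shows "card {i. i < d \<and> beta_sq_desc d \<beta> k < (\<beta> i)\<^sup>2} < k"
proof -
  let ?xs = "order_stats_inc d (\<lambda>i. (\<beta> i)\<^sup>2)"
  let ?t = "beta_sq_desc d \<beta> k"
  have len: "length ?xs = d" and sorted: "sorted ?xs" by (simp_all add: order_stats_inc_def)
  \<comment> \<open>In increasing order the k-th largest entry sits at position d - k, so strictly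
    larger entries occupy only the k - 1 positions after it.\<close>
  have t: "?t = ?xs ! (d - k)"
    using assms len by (simp add: beta_sq_desc_def rev_nth)
  have "card {i. i < d \<and> ?t < (\<beta> i)\<^sup>2} = size (filter_mset (\<lambda>x. ?t < x) (mset ?xs))"
  proof -
    have "mset ?xs = image_mset (\<lambda>i. (\<beta> i)\<^sup>2) (mset_set {..<d})"
      by (simp add: order_stats_inc_def lessThan_atLeast0)
    then show ?thesis by (simp add: filter_mset_image_mset filter_mset_mset_set)
  qed
  also have "\<dots> = card {i. i < d \<and> ?t < ?xs ! i}"
    unfolding mset_filter[symmetric] size_mset length_filter_conv_card len ..
  also have "\<dots> \<le> card {d - k<..<d}"
  proof (intro card_mono subsetI)
    fix i assume i: "i \<in> {i. i < d \<and> ?t < ?xs ! i}"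
    have "\<not> i \<le> d - k" using i t sorted_nth_mono[OF sorted, of i "d - k"] assms len by force
    then show "i \<in> {d - k<..<d}" using i by auto
  qed auto
  also have "\<dots> < k" using assms by auto
  finally show ?thesis .
qed

section \<open>Lower bounds on the diagonal of \<Delta>\<close>

text \<open>Splitting x = s u + y with y orthogonal to the eigenvector u removes the cross terms,
  since S y is orthogonal to u as well. What remains beside \<lambda> s^2 is the form at y, which is
  nonnegative.\<close>

lemma pos_def_rank_one_le:
  assumes "pos_def d S" "eigen_decomp d S lam u" "l < d"
  shows "lam l * (\<Sum>i<d. u l i * x i)\<^sup>2 \<le> quad_form d S x"
proof -
  define s where "s = (\<Sum>i<d. u l i * x i)"
  have Su: "(\<Sum>j<d. S i j * u l j) = lam l * u l i" if "i < d" for i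
    using assms(2,3) that by (simp add: eigen_decomp_def)
  have uu: "(\<Sum>i<d. u l i * u l i) = 1" using assms(2,3) by (simp add: eigen_decomp_def)
  have sym: "S i j = S j i" if "i < d" "j < d" for i j
    using assms(1) that by (simp add: pos_def_def sym_mat_def)
  have uS: "(\<Sum>i<d. u l i * (\<Sum>j<d. S i j * x j)) = lam l * s"
  proof -
    have "(\<Sum>i<d. u l i * (\<Sum>j<d. S i j * x j)) = (\<Sum>i<d. \<Sum>j<d. x j * (S j i * u l i))"
      by (auto simp: sum_distrib_left sym intro!: sum.cong)
    also have "\<dots> = (\<Sum>j<d. x j * (\<Sum>i<d. S j i * u l i))"
      by (subst sum.swap) (simp add: sum_distrib_left)
    also have "\<dots> = lam l * s" by (simp add: Su s_def sum_distrib_left mult_ac)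
    finally show ?thesis .
  qed
  define y where "y i = x i - s * u l i" for i
  have Sy: "(\<Sum>j<d. S i j * y j) = (\<Sum>j<d. S i j * x j) - s * (lam l * u l i)" if "i < d" for i
    by (simp add: y_def right_diff_distrib sum_subtractf mult.left_commute flip: sum_distrib_left Su[OF that])
  have "quad_form d S y = (\<Sum>i<d. y i * ((\<Sum>j<d. S i j * x j) - s * (lam l * u l i)))"
    by (simp add: quad_form_eq_sum Sy)
  also have "\<dots> = (\<Sum>i<d. x i * (\<Sum>j<d. S i j * x j)) - s * lam l * (\<Sum>i<d. u l i * x i)
      - s * (\<Sum>i<d. u l i * (\<Sum>j<d. S i j * x j)) + s * s * lam l * (\<Sum>i<d. u l i * u l i)"
    unfolding y_def by (simp add: algebra_simps sum.distrib sum_subtractf sum_distrib_left)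
  also have "\<dots> = quad_form d S x - lam l * s\<^sup>2"
    by (simp add: uu uS quad_form_eq_sum flip: s_def) (simp add: power2_eq_square)
  finally have "quad_form d S y = quad_form d S x - lam l * s\<^sup>2" .
  moreover have "quad_form d S y \<ge> 0"
  proof (cases "\<exists>i<d. y i \<noteq> 0")
    case True
    then show ?thesis using assms(1) unfolding pos_def_def by (meson less_imp_le)
  qed (auto simp: quad_form_def)
  ultimately show ?thesis by (simp add: s_def)
qed

lemma quad_form_unit:
  assumes "i < d"
  shows "quad_form d S (\<lambda>j. if j = i then 1 else 0) = S i i"
proof -
  have "quad_form d S (\<lambda>j. if j = i then 1 else 0)
      = (\<Sum>a<d. if a = i then (\<Sum>b<d. if b = i then S a b else 0) else 0)"
    unfolding quad_form_def by (intro sum.cong refl) (simp add: if_distrib[of "times _"] cong: if_cong)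
  also have "\<dots> = S i i" using assms by simp
  finally show ?thesis .
qed

lemma pos_def_diag_pos:
  assumes "pos_def d S" "i < d"
  shows "S i i > 0"
proof -
  have "(\<exists>j<d. x j \<noteq> 0) \<Longrightarrow> quad_form d S x > 0" for x
    using assms(1) unfolding pos_def_def by blast
  from this[of "\<lambda>j. if j = i then 1 else 0"] show ?thesis
    using assms(2) by (auto simp: quad_form_unit)
qed

lemma quad_form_diag_minus:
  "quad_form d (\<lambda>i j. diag_mat \<delta> i j - S i j) x = (\<Sum>i<d. \<delta> i * (x i)\<^sup>2) - quad_form d S x"
proof -
  have "quad_form d (\<lambda>i j. diag_mat \<delta> i j - S i j) x
      = (\<Sum>i<d. \<Sum>j<d. x i * diag_mat \<delta> i j * x j) - quad_form d S x"
    by (simp add: quad_form_def algebra_simps sum_subtractf)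
  also have "(\<Sum>i<d. \<Sum>j<d. x i * diag_mat \<delta> i j * x j) = (\<Sum>i<d. \<delta> i * (x i)\<^sup>2)"
    by (intro sum.cong refl)
      (simp add: diag_mat_def if_distrib if_distribR power2_eq_square mult_ac cong: if_cong)
  finally show ?thesis .
qed

lemma loewner_diag_pos:
  assumes "pos_def d S" "loewner_ge d (diag_mat \<delta>) S" "i < d"
  shows "\<delta> i > 0"
proof -
  have "quad_form d (\<lambda>i j. diag_mat \<delta> i j - S i j) (\<lambda>j. if j = i then 1 else 0) \<ge> 0"
    using assms(2) unfolding loewner_ge_def pos_semidef_def by blast
  then have "S i i \<le> \<delta> i"
    by (simp add: quad_form_unit[OF assms(3)] diag_mat_def)
  with pos_def_diag_pos[OF assms(1,3)] show ?thesis by simp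
qed

text \<open>Testing \<open>\<Delta> \<succeq> \<lambda> u u\<^sup>T\<close> on the restriction of \<open>u\<close> to \<open>K\<close> bounds the largest
  diagonal entry over \<open>K\<close> from below.\<close>
lemma exists_large_diag:
  assumes S: "pos_def d S" and eig: "eigen_decomp d S lam u" and ge: "loewner_ge d (diag_mat \<delta>) S"
    and k: "1 \<le> k" "0 < b_k d lam u k" and K: "K \<subseteq> {..<d}" "k \<le> card K"
  shows "\<exists>i\<in>K. real (card K) * b_k d lam u k \<le> real k * \<delta> i"
proof (rule ccontr)
  assume "\<not> ?thesis"
  then have less: "real k * \<delta> i < real (card K) * b_k d lam u k" if "i \<in> K" for i
    using that by (meson not_le)
  let ?f = "\<lambda>l. lam l * sum_list (take k (order_stats_inc d (\<lambda>i. (u l i)\<^sup>2)))"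
  have fin: "finite K" using K(1) finite_subset by blast
  have "{..<d} \<noteq> {}" using K k by (auto simp: fin)
  then have "b_k d lam u k \<in> ?f ` {..<d}"
    unfolding b_k_def by (intro Max_in) auto
  then obtain l where l: "l < d" "b_k d lam u k = ?f l" by auto
  define s where "s = sum_list (take k (order_stats_inc d (\<lambda>i. (u l i)\<^sup>2)))"
  have s0: "s \<ge> 0" unfolding s_def
    by (rule sum_list_nonneg) (auto simp: order_stats_inc_def dest!: in_set_takeD)
  have pos: "lam l > 0" "s > 0" using k(2) s0 l(2) unfolding s_def[symmetric]
    by (auto simp: zero_less_mult_iff)
  define U where "U = (\<Sum>i\<in>K. (u l i)\<^sup>2)"
  have mean: "real (card K) * s \<le> real k * U"
    unfolding s_def U_def by (rule mean_smallest_le_mean) (use K k in auto)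
  have "real (card K) * s > 0" using K k pos by simp
  with mean have U: "U > 0" using k(1) by (smt (verit) mult_nonneg_nonpos of_nat_0_le_iff)
  define x where "x i = (if i \<in> K then u l i else 0)" for i
  have ux: "(\<Sum>i<d. u l i * x i) = U"
    unfolding U_def x_def using K(1)
    by (intro sum.mono_neutral_cong_right) (auto simp: power2_eq_square)
  have dx: "(\<Sum>i<d. \<delta> i * (x i)\<^sup>2) = (\<Sum>i\<in>K. \<delta> i * (u l i)\<^sup>2)"
    unfolding x_def using K(1) by (intro sum.mono_neutral_cong_right) auto
  have "quad_form d (\<lambda>i j. diag_mat \<delta> i j - S i j) x \<ge> 0"
    using ge unfolding loewner_ge_def pos_semidef_def by blast
  then have "lam l * U\<^sup>2 \<le> (\<Sum>i\<in>K. \<delta> i * (u l i)\<^sup>2)"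
    using pos_def_rank_one_le[OF S eig l(1), of x] by (simp add: quad_form_diag_minus ux dx)
  then have "real k * (lam l * U\<^sup>2) \<le> (\<Sum>i\<in>K. real k * \<delta> i * (u l i)\<^sup>2)"
    by (metis (no_types, lifting) mult.assoc mult_left_mono of_nat_0_le_iff sum.cong sum_distrib_left)
  \<comment> \<open>If every \<delta> on K were smaller than claimed, the right side would fall
    below card K * b_k * U = \<lambda> U card K s, while \<open>mean\<close> bounds this by k
    \<lambda> U^2, the left side. Strictness comes from an index with u nonzero, which exists
    because U > 0.\<close>
  also have "\<dots> < (\<Sum>i\<in>K. real (card K) * b_k d lam u k * (u l i)\<^sup>2)"
  proof (rule sum_strict_mono_ex1[OF fin])
    show "\<forall>i\<in>K. real k * \<delta> i * (u l i)\<^sup>2 \<le> real (card K) * b_k d lam u k * (u l i)\<^sup>2"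
      using less by (meson mult_right_mono less_imp_le zero_le_power2)
    have "\<exists>i\<in>K. (u l i)\<^sup>2 > 0"
      using U sum_nonpos[of K "\<lambda>i. (u l i)\<^sup>2"] unfolding U_def by (meson not_le)
    then show "\<exists>i\<in>K. real k * \<delta> i * (u l i)\<^sup>2 < real (card K) * b_k d lam u k * (u l i)\<^sup>2"
      using less by (meson mult_strict_right_mono)
  qed
  also have "\<dots> = real (card K) * b_k d lam u k * U"
    by (simp add: U_def sum_distrib_left)
  also have "\<dots> = lam l * U * (real (card K) * s)"
    by (simp add: l(2) s_def)
  also have "\<dots> \<le> lam l * U * (real k * U)"
    by (rule mult_left_mono[OF mean]) (use pos U in simp)
  finally show False by (simp add: power2_eq_square mult_ac)
qed

text \<open>The subtracted term makes the induction telescope, through k^2/(n+1)^2 <= k^2/n -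
  k^2/(n+1).\<close>

lemma sum_inverse_squares_tail:
  assumes "1 \<le> k" "k \<le> n"
  shows "(\<Sum>m=1..n. min 1 ((real k / real m)\<^sup>2)) \<le> 2 * real k - (real k)\<^sup>2 / real n"
  using assms(2)
proof (induction n rule: dec_induct)
  case base
  have "(\<Sum>m=1..k. min 1 ((real k / real m)\<^sup>2)) \<le> (\<Sum>m=1..k. 1)" by (intro sum_mono) simp
  then show ?case using assms(1) by (simp add: power2_eq_square)
next
  case (step n)
  have n: "real n > 0" using step assms by simp
  have "(\<Sum>m=1..Suc n. min 1 ((real k / real m)\<^sup>2))
      \<le> 2 * real k - (real k)\<^sup>2 / real n + (real k)\<^sup>2 / (real n + 1)\<^sup>2"
    using step.IH by (simp add: power_divide add.commute add_mono)
  also have "(real k)\<^sup>2 / (real n + 1)\<^sup>2 \<le> (real k)\<^sup>2 / (real n * (real n + 1))"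
    using n by (intro divide_left_mono) (auto simp: power2_eq_square)
  also have "(real k)\<^sup>2 / (real n * (real n + 1)) = (real k)\<^sup>2 / real n - (real k)\<^sup>2 / real (Suc n)"
    using n by (simp add: field_simps)
  finally show ?case by simp
qed

text \<open>Peel off one index at a time: from a set of size m remove one with \<rho> at most k/m.
  The sum is then dominated by that of min 1 ((k/m)^2) over m.\<close>

lemma sum_min_squares_le:
  assumes fin: "finite I" and k: "1 \<le> k"
    and small: "\<And>K. K \<subseteq> I \<Longrightarrow> k \<le> card K \<Longrightarrow> \<exists>i\<in>K. \<rho> i \<le> real k / real (card K)"
    and nonneg: "\<And>i. i \<in> I \<Longrightarrow> 0 \<le> \<rho> i"
  shows "(\<Sum>i\<in>I. min 1 ((\<rho> i)\<^sup>2)) \<le> 2 * real k"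
proof -
  have "(\<Sum>i\<in>K. min 1 ((\<rho> i)\<^sup>2)) \<le> (\<Sum>m=1..card K. min 1 ((real k / real m)\<^sup>2))"
    if "K \<subseteq> I" for K
    using finite_subset[OF that fin] that
  proof (induction "card K" arbitrary: K)
    case (Suc n)
    obtain i where i: "i \<in> K" "min 1 ((\<rho> i)\<^sup>2) \<le> min 1 ((real k / real (card K))\<^sup>2)"
    proof (cases "k \<le> card K")
      case True
      then obtain i where "i \<in> K" "\<rho> i \<le> real k / real (card K)" using small Suc by blast
      then show ?thesis using nonneg Suc.prems
        by (intro that[of i] min.mono power_mono) auto
    next
      case False
      obtain i where "i \<in> K" using Suc(2) by fastforce
      \<comment> \<open>Below size k nothing is known about \<rho>, but the bound to be met is 1, so
        any index can be removed.\<close>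
      have "1 \<le> real k / real (card K)" using False Suc(2) by simp
      then have "1 \<le> (real k / real (card K))\<^sup>2" by simp
      with \<open>i \<in> K\<close> show ?thesis by (intro that[of i]) auto
    qed
    have "(\<Sum>i\<in>K. min 1 ((\<rho> i)\<^sup>2)) = min 1 ((\<rho> i)\<^sup>2) + (\<Sum>i\<in>K-{i}. min 1 ((\<rho> i)\<^sup>2))"
      using i Suc.prems by (simp add: sum.remove)
    also have "(\<Sum>i\<in>K-{i}. min 1 ((\<rho> i)\<^sup>2)) \<le> (\<Sum>m=1..n. min 1 ((real k / real m)\<^sup>2))"
    proof -
      have n: "n = card (K - {i})" using Suc.hyps(2) Suc.prems i(1) by simp
      show ?thesis using Suc.hyps(1)[OF n] Suc.prems unfolding n by blast
    qed
    finally show ?case using i(2) Suc(2)[symmetric] by simp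
  qed auto
  from this[of I] have "(\<Sum>i\<in>I. min 1 ((\<rho> i)\<^sup>2)) \<le> (\<Sum>m=1..card I. min 1 ((real k / real m)\<^sup>2))"
    by simp
  also have "\<dots> \<le> 2 * real k"
  proof (cases "k \<le> card I")
    case True
    have "(real k)\<^sup>2 / real (card I) \<ge> 0" by simp
    with sum_inverse_squares_tail[OF k True] show ?thesis by linarith
  next
    case False
    have "(\<Sum>m=1..card I. min 1 ((real k / real m)\<^sup>2)) \<le> (\<Sum>m=1..card I. 1)" by (intro sum_mono) simp
    with False show ?thesis by simp
  qed
  finally show ?thesis .
qed

subsection \<open>Reflections preserve Lebesgue measure\<close>

abbreviation leb :: "nat \<Rightarrow> (nat \<Rightarrow> real) measure" where
  "leb d \<equiv> \<Pi>\<^sub>M i\<in>{..<d}. lborel"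

lemma sigma_finite_leb: "sigma_finite_measure (leb d)"
proof -
  interpret product_sigma_finite "\<lambda>_::nat. lborel :: real measure" ..
  show ?thesis by (rule sigma_finite) simp
qed

text \<open>Lets a change of variables in one component be checked with the other component
  frozen.\<close>

lemma nn_integral_pair_cong_snd:
  assumes "sigma_finite_measure N" "F \<in> borel_measurable (M \<Otimes>\<^sub>M N)" "F' \<in> borel_measurable (M \<Otimes>\<^sub>M N)"
    and "\<And>x. x \<in> space M \<Longrightarrow> (\<integral>\<^sup>+y. F (x, y) \<partial>N) = (\<integral>\<^sup>+y. F' (x, y) \<partial>N)"
  shows "(\<integral>\<^sup>+v. F v \<partial>(M \<Otimes>\<^sub>M N)) = (\<integral>\<^sup>+v. F' v \<partial>(M \<Otimes>\<^sub>M N))"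
  unfolding sigma_finite_measure.nn_integral_fst[OF assms(1,2), symmetric]
    sigma_finite_measure.nn_integral_fst[OF assms(1,3), symmetric]
  by (intro nn_integral_cong assms(4))

lemma nn_integral_pair_cong_fst:
  assumes "sigma_finite_measure M" "sigma_finite_measure N"
    and "F \<in> borel_measurable (M \<Otimes>\<^sub>M N)" "F' \<in> borel_measurable (M \<Otimes>\<^sub>M N)"
    and "\<And>y. y \<in> space N \<Longrightarrow> (\<integral>\<^sup>+x. F (x, y) \<partial>M) = (\<integral>\<^sup>+x. F' (x, y) \<partial>M)"
  shows "(\<integral>\<^sup>+v. F v \<partial>(M \<Otimes>\<^sub>M N)) = (\<integral>\<^sup>+v. F' v \<partial>(M \<Otimes>\<^sub>M N))"
proof -
  interpret pair_sigma_finite M N by (intro pair_sigma_finite.intro assms)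
  show ?thesis
    unfolding nn_integral_snd[OF assms(3), symmetric] nn_integral_snd[OF assms(4), symmetric]
    by (intro nn_integral_cong assms(5))
qed

text \<open>Fubini isolates coordinate p. Since g ignores that coordinate, the inner integral
  undergoes a one-dimensional affine substitution with Jacobian |a|.\<close>

lemma nn_integral_coord_affine:
  assumes p: "p < d" and a: "a \<noteq> 0" and F[measurable]: "F \<in> borel_measurable (leb d)"
    and g[measurable]: "g \<in> borel_measurable (leb d)" and gp: "\<And>z y. g (z(p := y)) = g z"
  shows "ennreal \<bar>a\<bar> * (\<integral>\<^sup>+z. F (z(p := a * z p + g z)) \<partial>leb d) = (\<integral>\<^sup>+z. F z \<partial>leb d)"
proof -
  interpret product_sigma_finite "\<lambda>_::nat. lborel :: real measure" ..
  define I where "I = {..<d} - {p}"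
  have I: "finite I" "p \<notin> I" "{..<d} = insert p I" using p by (auto simp: I_def)
  have upd[measurable]: "(\<lambda>z. z(p := a * z p + g z)) \<in> measurable (leb d) (leb d)"
    by (rule measurable_fun_upd[where J="{..<d}"]) (use p in auto)
  have upd2[measurable]: "(\<lambda>(x, y). x(p := y)) \<in> measurable (PiM I (\<lambda>_. lborel) \<Otimes>\<^sub>M lborel) (leb d)"
    unfolding I(3) by (rule measurable_add_dim)
  \<comment> \<open>On vectors without coordinate p, g agrees with its value after setting that
    coordinate to 0, which transfers measurability.\<close>
  have gx[measurable]: "(\<lambda>x. g x) \<in> borel_measurable (PiM I (\<lambda>_. lborel))"
  proof -
    have "(\<lambda>x. g (x(p := 0))) \<in> borel_measurable (PiM I (\<lambda>_. lborel))"
      using measurable_compose[OF measurable_compose[OF measurable_Pair[OF measurable_ident_sets[OF refl] measurable_const[of 0]] upd2] g]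
      by simp
    then show ?thesis by (simp add: gp)
  qed
  have "(\<integral>\<^sup>+z. F z \<partial>leb d) = (\<integral>\<^sup>+x. \<integral>\<^sup>+y. F (x(p := y)) \<partial>lborel \<partial>PiM I (\<lambda>_. lborel))"
    by (rule product_nn_integral_insert[OF I(1,2), folded I(3), OF F])
  also have "\<dots> = (\<integral>\<^sup>+x. \<bar>a\<bar> * (\<integral>\<^sup>+y. F (x(p := g x + a * y)) \<partial>lborel) \<partial>PiM I (\<lambda>_. lborel))"
  proof (intro nn_integral_cong)
    fix x assume x: "x \<in> space (PiM I (\<lambda>_. lborel :: real measure))"
    have "(\<lambda>y. F (x(p := y))) \<in> borel_measurable borel"
      using measurable_compose[OF measurable_compose[OF measurable_Pair1'[OF x, of lborel] upd2] F] by simp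
    from nn_integral_real_affine[OF this a, of "g x"]
    show "(\<integral>\<^sup>+y. F (x(p := y)) \<partial>lborel) = \<bar>a\<bar> * (\<integral>\<^sup>+y. F (x(p := g x + a * y)) \<partial>lborel)" .
  qed
  also have "\<dots> = \<bar>a\<bar> * (\<integral>\<^sup>+x. (\<integral>\<^sup>+y. F (x(p := g x + a * y)) \<partial>lborel) \<partial>PiM I (\<lambda>_. lborel))"
  proof (rule nn_integral_cmult)
    have "(\<lambda>(x, y). F (x(p := g x + a * y))) = F \<circ> (\<lambda>(x, y). x(p := y)) \<circ> (\<lambda>(x,y). (x, g x + a * y))"
      by auto
    also have "\<dots> \<in> borel_measurable (PiM I (\<lambda>_. lborel) \<Otimes>\<^sub>M lborel)"
      by (intro measurable_comp[of _ _ "PiM I (\<lambda>_. lborel) \<Otimes>\<^sub>M lborel"] measurable_comp[OF upd2 F]) measurable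
    finally have [measurable]: "(\<lambda>(x, y). F (x(p := g x + a * y))) \<in> borel_measurable (PiM I (\<lambda>_. lborel) \<Otimes>\<^sub>M lborel)" .
    show "(\<lambda>x. \<integral>\<^sup>+y. F (x(p := g x + a * y)) \<partial>lborel) \<in> borel_measurable (PiM I (\<lambda>_. lborel))"
      by measurable
  qed
  also have "(\<integral>\<^sup>+x. (\<integral>\<^sup>+y. F (x(p := g x + a * y)) \<partial>lborel) \<partial>PiM I (\<lambda>_. lborel))
      = (\<integral>\<^sup>+z. F (z(p := a * z p + g z)) \<partial>leb d)"
  proof -
    have "(\<lambda>z. F (z(p := a * z p + g z))) \<in> borel_measurable (leb d)" by measurable
    from product_nn_integral_insert[OF I(1,2), folded I(3), OF this]
    show ?thesis by (simp add: gp add.commute)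
  qed
  finally show ?thesis ..
qed

lemma measurable_coord_shift[measurable]:
  assumes [measurable]: "h \<in> borel_measurable (leb d)"
  shows "(\<lambda>z. \<lambda>q\<in>{..<d}. if q \<in> Q then z q + h z * c q else z q) \<in> measurable (leb d) (leb d)"
  by (rule measurable_restrict) (auto intro!: measurable_If)

text \<open>A shear is a succession of one-coordinate translations. The amount h ignores every
  coordinate in Q, so it stays the same along the way.\<close>

lemma nn_integral_coord_shift:
  assumes Q: "Q \<subseteq> {..<d}" and F: "F \<in> borel_measurable (leb d)"
    and h[measurable]: "h \<in> borel_measurable (leb d)" and hq: "\<And>q z y. q \<in> Q \<Longrightarrow> h (z(q := y)) = h z"
  shows "(\<integral>\<^sup>+z. F (\<lambda>q\<in>{..<d}. if q \<in> Q then z q + h z * c q else z q) \<partial>leb d) = (\<integral>\<^sup>+z. F z \<partial>leb d)"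
proof -
  have "finite Q" using Q finite_subset by blast
  then show ?thesis using Q hq
  proof (induction Q rule: finite_induct)
    case empty
    show ?case by (intro nn_integral_cong) (auto simp: space_PiM PiE_def extensional_restrict)
  next
    case (insert q Q)
    have q: "q < d" using insert by simp
    have [measurable]: "(\<lambda>z. F (\<lambda>q\<in>{..<d}. if q \<in> Q then z q + h z * c q else z q)) \<in> borel_measurable (leb d)"
      using F by measurable
    have "(\<integral>\<^sup>+z. F (\<lambda>r\<in>{..<d}. if r \<in> insert q Q then z r + h z * c r else z r) \<partial>leb d)
      = (\<integral>\<^sup>+z. (\<lambda>z. F (\<lambda>q\<in>{..<d}. if q \<in> Q then z q + h z * c q else z q)) (z(q := 1 * z q + h z * c q)) \<partial>leb d)"
      unfolding insert.prems(2)[OF insertI1] using insert.hyps(2)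
      by (intro nn_integral_cong arg_cong[of _ _ F]) (auto simp: fun_eq_iff)
    also have "\<dots> = (\<integral>\<^sup>+z. F (\<lambda>q\<in>{..<d}. if q \<in> Q then z q + h z * c q else z q) \<partial>leb d)"
      using nn_integral_coord_affine[OF q, of 1 "\<lambda>z. F (\<lambda>q\<in>{..<d}. if q \<in> Q then z q + h z * c q else z q)" "\<lambda>z. h z * c q"]
      by (simp add: insert.prems(2)[OF insertI1])
    also have "\<dots> = (\<integral>\<^sup>+z. F z \<partial>leb d)" by (rule insert.IH) (use insert.prems in auto)
    finally show ?case .
  qed
qed

text \<open>In the coordinates obtained by replacing \<open>z p\<close> by the affine functional \<open>s\<close>, the reflection
  is a sign change of one coordinate followed by shears.\<close>
lemma nn_integral_reflection:
  fixes a b :: "nat \<Rightarrow> real" and m :: real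
  assumes p: "p < d" "a p \<noteq> 0" and F[measurable]: "F \<in> borel_measurable (leb d \<Otimes>\<^sub>M leb d)"
  defines "D \<equiv> (\<Sum>q<d. (a q)\<^sup>2) + (\<Sum>q<d. (b q)\<^sup>2)"
    and "s \<equiv> \<lambda>z w. m + (\<Sum>q<d. a q * z q) + (\<Sum>q<d. b q * w q)"
  shows "(\<integral>\<^sup>+v. F (\<lambda>q\<in>{..<d}. fst v q - 2 * s (fst v) (snd v) / D * a q,
        \<lambda>q\<in>{..<d}. snd v q - 2 * s (fst v) (snd v) / D * b q)
      \<partial>(leb d \<Otimes>\<^sub>M leb d)) = (\<integral>\<^sup>+v. F v \<partial>(leb d \<Otimes>\<^sub>M leb d))"
proof -
  let ?N = "leb d \<Otimes>\<^sub>M leb d"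
  note sf = sigma_finite_leb[of d]
  define g where "g z w = m + (\<Sum>q\<in>{..<d} - {p}. a q * z q) + (\<Sum>q<d. b q * w q)" for z w
  have s_g: "s z w = a p * z p + g z w" for z w
    using p by (simp add: s_def g_def sum.remove[of "{..<d}" p])
  have g_upd: "g (z(p := y)) w = g z w" for z w y by (simp add: g_def)
  have g_meas[measurable]: "(\<lambda>(z, w). g z w) \<in> borel_measurable ?N"
    unfolding g_def by measurable
  have D: "D > 0"
  proof -
    have "(a p)\<^sup>2 \<le> (\<Sum>q<d. (a q)\<^sup>2)" using p by (intro member_le_sum) auto
    then show ?thesis using p by (simp add: D_def add_pos_nonneg sum_nonneg
          order_less_le_trans[of 0 "(a p)\<^sup>2"])
  qed
  define L where "L = (\<lambda>(z, w). (z(p := a p * z p + g z w), w))"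
  define L' where "L' = (\<lambda>(z, w). (z(p := (z p - g z w) / a p), w))"
  \<comment> \<open>After \<open>L\<close>, coordinate p holds s. \<open>S1\<close> and
    \<open>S2\<close> use it to move \<open>w\<close> and the remaining \<open>z\<close>
    coordinates, and only then does \<open>S3\<close> negate it.\<close>
  define S1 where "S1 = (\<lambda>(z::nat\<Rightarrow>real, w). (z, \<lambda>q\<in>{..<d}. if q \<in> {..<d} then w q + z p * (- 2 / D * b q) else w q))"
  define S2 where "S2 = (\<lambda>(z, w::nat\<Rightarrow>real). (\<lambda>q\<in>{..<d}. if q \<in> {..<d} - {p} then z q + z p * (- 2 / D * a q) else z q, w))"
  define S3 where "S3 = (\<lambda>(z::nat\<Rightarrow>real, w::nat\<Rightarrow>real). (z(p := -1 * z p + 0), w))"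
  have p': "p \<in> {..<d}" using p by simp
  have comp[measurable]: "(\<lambda>x. x p) \<in> borel_measurable (leb d)" using p' by measurable
  have upd: "(\<lambda>(z, w). (z(p := f z w), w)) \<in> measurable ?N ?N" if "(\<lambda>(z, w). f z w) \<in> borel_measurable ?N" for f
  proof -
    have "(\<lambda>v. ((fst v)(p := (\<lambda>(z, w). f z w) v), snd v)) \<in> measurable ?N ?N"
      by (intro measurable_Pair measurable_fun_upd[where J="{..<d}"]) (use p that in auto)
    then show ?thesis by (simp add: case_prod_beta)
  qed
  have [measurable]: "L \<in> measurable ?N ?N" unfolding L_def by (rule upd) measurable
  have [measurable]: "L' \<in> measurable ?N ?N" unfolding L'_def by (rule upd) measurable
  have [measurable]: "S3 \<in> measurable ?N ?N" unfolding S3_def by (rule upd) measurable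
  have [measurable]: "S1 \<in> measurable ?N ?N"
    unfolding S1_def case_prod_beta by (intro measurable_Pair measurable_restrict) auto
  have [measurable]: "S2 \<in> measurable ?N ?N"
    unfolding S2_def case_prod_beta by (intro measurable_Pair measurable_restrict measurable_If) auto
  have L: "\<bar>a p\<bar> * (\<integral>\<^sup>+v. H (L v) \<partial>?N) = (\<integral>\<^sup>+v. H v \<partial>?N)" if [measurable]: "H \<in> borel_measurable ?N" for H
  proof -
    have "(\<integral>\<^sup>+v. \<bar>a p\<bar> * H (L v) \<partial>?N) = (\<integral>\<^sup>+v. H v \<partial>?N)"
    proof (rule nn_integral_pair_cong_fst[OF sf sf])
      fix w assume w: "w \<in> space (leb d)"
      have Lw: "(\<lambda>z. (z, w)) \<in> measurable (leb d) ?N" using w by measurable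
      have "(\<integral>\<^sup>+z. \<bar>a p\<bar> * H (L (z, w)) \<partial>leb d) = \<bar>a p\<bar> * (\<integral>\<^sup>+z. H (L (z, w)) \<partial>leb d)"
        by (rule nn_integral_cmult) (use w in measurable)
      also have "\<dots> = (\<integral>\<^sup>+z. H (z, w) \<partial>leb d)"
        using nn_integral_coord_affine[OF p, of "\<lambda>z. H (z, w)" "\<lambda>z. g z w"]
          measurable_compose[OF Lw that] measurable_compose[OF Lw g_meas]
        by (simp add: L_def g_upd)
      finally show "(\<integral>\<^sup>+z. \<bar>a p\<bar> * H (L (z, w)) \<partial>leb d) = (\<integral>\<^sup>+z. H (z, w) \<partial>leb d)" .
    qed measurable
    then show ?thesis by (subst (asm) nn_integral_cmult) measurable
  qed
  have S1: "(\<integral>\<^sup>+v. H (S1 v) \<partial>?N) = (\<integral>\<^sup>+v. H v \<partial>?N)" if [measurable]: "H \<in> borel_measurable ?N" for H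
  proof (rule nn_integral_pair_cong_snd[OF sf])
    fix z assume z: "z \<in> space (leb d)"
    show "(\<integral>\<^sup>+w. H (S1 (z, w)) \<partial>leb d) = (\<integral>\<^sup>+w. H (z, w) \<partial>leb d)"
      unfolding S1_def prod.case
      by (rule nn_integral_coord_shift[where F="\<lambda>w. H (z, w)" and h="\<lambda>_. z p"])
        (use z in \<open>auto intro!: measurable_compose[OF _ that]\<close>)
  qed measurable
  have S2: "(\<integral>\<^sup>+v. H (S2 v) \<partial>?N) = (\<integral>\<^sup>+v. H v \<partial>?N)" if [measurable]: "H \<in> borel_measurable ?N" for H
  proof (rule nn_integral_pair_cong_fst[OF sf sf])
    fix w assume w: "w \<in> space (leb d)"
    show "(\<integral>\<^sup>+z. H (S2 (z, w)) \<partial>leb d) = (\<integral>\<^sup>+z. H (z, w) \<partial>leb d)"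
      unfolding S2_def prod.case
      by (rule nn_integral_coord_shift[where F="\<lambda>z. H (z, w)" and h="\<lambda>z. z p"])
        (use w comp in \<open>auto intro!: measurable_compose[OF _ that]\<close>)
  qed measurable
  have S3: "(\<integral>\<^sup>+v. H (S3 v) \<partial>?N) = (\<integral>\<^sup>+v. H v \<partial>?N)" if [measurable]: "H \<in> borel_measurable ?N" for H
  proof (rule nn_integral_pair_cong_fst[OF sf sf])
    fix w assume w: "w \<in> space (leb d)"
    have "(\<lambda>z. H (z, w)) \<in> borel_measurable (leb d)"
      by (rule measurable_compose[OF _ that]) (use w in measurable)
    from nn_integral_coord_affine[OF p(1) _ this, of "-1" "\<lambda>_. 0"]
    show "(\<integral>\<^sup>+z. H (S3 (z, w)) \<partial>leb d) = (\<integral>\<^sup>+z. H (z, w) \<partial>leb d)"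
      by (simp add: S3_def)
  qed measurable
  define T where "T = (\<lambda>(z, w). (\<lambda>q\<in>{..<d}. z q - 2 * s z w / D * a q, \<lambda>q\<in>{..<d}. w q - 2 * s z w / D * b q))"
  \<comment> \<open>\<open>L'\<close> undoes \<open>L\<close>, so G after \<open>L\<close> is F.
    This lets the change to the new coordinates be reversed at the end.\<close>
  define G where "G v = F (L' v)" for v
  have [measurable]: "G \<in> borel_measurable ?N" unfolding G_def by measurable
  have GL: "G (L v) = F v" if "v \<in> space ?N" for v
    using p by (cases v) (simp add: G_def L_def L'_def g_upd)
  have GSL: "G (S3 (S2 (S1 (L v)))) = F (T v)" if v: "v \<in> space ?N" for v
  proof -
    obtain z w where vz: "v = (z, w)" by fastforce
    define y where "y = (\<lambda>q\<in>{..<d}. z q - 2 * s z w / D * a q)"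
    define x where "x = (\<lambda>q\<in>{..<d}. w q - 2 * s z w / D * b q)"
    have 1: "S3 (S2 (S1 (L v))) = (y(p := - s z w), x)"
      using p by (auto simp: vz L_def S1_def S2_def S3_def y_def x_def s_g fun_eq_iff restrict_def)
    \<comment> \<open>Moving by -t along (a, b) lowers s by t D, so t = 2 s / D turns s into -s.
      Hence the negated p-th coordinate is the one that belongs to the reflected point.\<close>
    have "m + (\<Sum>q<d. a q * (z q - t * a q)) + (\<Sum>q<d. b q * (w q - t * b q)) = s z w - t * D" for t
      by (simp add: s_def D_def algebra_simps sum_subtractf sum_distrib_left power2_eq_square)
    from this[of "2 * s z w / D"] have "s y x = s z w - 2 * s z w / D * D"
      by (simp add: s_def y_def x_def)
    then have "s y x = - s z w" using D by simp
    then have "a p * y p + g y x = - s z w" by (simp add: s_g)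
    then have "(- s z w - g y x) / a p = y p" using p by (simp add: field_simps)
    then have "L' (y(p := - s z w), x) = (y, x)" by (simp add: L'_def g_upd)
    then show ?thesis unfolding G_def 1 by (simp add: T_def vz y_def x_def)
  qed
  have "\<bar>a p\<bar> * (\<integral>\<^sup>+v. F (T v) \<partial>?N) = \<bar>a p\<bar> * (\<integral>\<^sup>+v. G (S3 (S2 (S1 (L v)))) \<partial>?N)"
    by (intro arg_cong2[of _ _ _ _ times] refl nn_integral_cong) (simp add: GSL)
  also have "\<dots> = (\<integral>\<^sup>+v. G (S3 (S2 (S1 v))) \<partial>?N)" by (rule L) measurable
  also have "\<dots> = (\<integral>\<^sup>+v. G (S3 (S2 v)) \<partial>?N)" by (rule S1) measurable
  also have "\<dots> = (\<integral>\<^sup>+v. G (S3 v) \<partial>?N)" by (rule S2) measurable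
  also have "\<dots> = (\<integral>\<^sup>+v. G v \<partial>?N)" by (rule S3) measurable
  also have "\<dots> = \<bar>a p\<bar> * (\<integral>\<^sup>+v. G (L v) \<partial>?N)" by (rule L[symmetric]) measurable
  also have "\<dots> = \<bar>a p\<bar> * (\<integral>\<^sup>+v. F v \<partial>?N)"
    by (intro arg_cong2[of _ _ _ _ times] refl nn_integral_cong) (simp add: GL)
  \<comment> \<open>The Jacobian of \<open>L\<close> enters once in each direction and cancels,
    being finite and nonzero.\<close>
  finally have "(\<integral>\<^sup>+v. F (T v) \<partial>?N) = (\<integral>\<^sup>+v. F v \<partial>?N)"
    using p by (simp add: ennreal_mult_cancel_left)
  then show ?thesis by (simp add: T_def case_prod_beta)
qed

subsection \<open>Gaussian vectors\<close>

lemma prob_space_std_gauss: "prob_space (std_gauss d)"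
  unfolding std_gauss_def by (intro prob_space_PiM prob_space_normal_density) simp

lemma sets_std_gauss[measurable_cong]: "sets (std_gauss d) = sets (leb d)"
  unfolding std_gauss_def by (intro sets_PiM_cong) auto

text \<open>Passes to Lebesgue measure, for which reflection invariance is available. A product
  measure is determined by its values on boxes, where the integral factors.\<close>

lemma std_gauss_eq_density:
  "std_gauss d = density (leb d) (\<lambda>z. \<Prod>i<d. ennreal (std_normal_density (z i)))"
proof -
  interpret L: product_sigma_finite "\<lambda>_::nat. lborel :: real measure" ..
  interpret G: product_prob_space "\<lambda>_::nat. density lborel std_normal_density"
    by (intro product_prob_spaceI prob_space_normal_density) simp
  show ?thesis unfolding std_gauss_def
  proof (rule G.PiM_eqI[symmetric])
    fix A :: "nat \<Rightarrow> real set"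
    assume "\<And>i. i \<in> {..<d} \<Longrightarrow> A i \<in> sets (density lborel (\<lambda>x. ennreal (std_normal_density x)))"
    then have A[measurable]: "A i \<in> sets borel" if "i < d" for i using that by simp
    have "emeasure (density (leb d) (\<lambda>z. \<Prod>i<d. ennreal (std_normal_density (z i)))) (Pi\<^sub>E {..<d} A)
        = (\<integral>\<^sup>+z. (\<Prod>i<d. ennreal (std_normal_density (z i))) * indicator (Pi\<^sub>E {..<d} A) z \<partial>leb d)"
      by (rule emeasure_density) (auto intro!: sets_PiM_I_finite)
    also have "\<dots> = (\<integral>\<^sup>+z. (\<Prod>i<d. ennreal (std_normal_density (z i)) * indicator (A i) (z i)) \<partial>leb d)"
    proof (intro nn_integral_cong)
      fix z assume "z \<in> space (leb d)"
      then have "z \<in> Pi\<^sub>E {..<d} A \<longleftrightarrow> (\<forall>i<d. z i \<in> A i)" by (auto simp: space_PiM PiE_iff)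
      then have "indicator (Pi\<^sub>E {..<d} A) z = (\<Prod>i<d. indicator (A i) (z i) :: ennreal)"
        by (auto simp: indicator_def intro!: prod.neutral[symmetric] prod_zero[symmetric])
      then show "(\<Prod>i<d. ennreal (std_normal_density (z i))) * indicator (Pi\<^sub>E {..<d} A) z
          = (\<Prod>i<d. ennreal (std_normal_density (z i)) * indicator (A i) (z i))"
        by (simp add: prod.distrib)
    qed
    also have "\<dots> = (\<Prod>i<d. \<integral>\<^sup>+x. ennreal (std_normal_density x) * indicator (A i) x \<partial>lborel)"
      by (rule L.product_nn_integral_prod) (use A in auto)
    also have "\<dots> = (\<Prod>i<d. emeasure (density lborel std_normal_density) (A i))"
      by (intro prod.cong refl emeasure_density[symmetric]) auto
    finally show "emeasure (density (leb d) (\<lambda>z. \<Prod>i<d. ennreal (std_normal_density (z i)))) (Pi\<^sub>E {..<d} A)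
        = (\<Prod>i<d. emeasure (density lborel std_normal_density) (A i))" .
  qed (auto intro!: sets_PiM_cong)
qed

text \<open>Joint density of the Gaussian pair, written through the squared norm so that its change
  under a flip can be read off from the change of that norm.\<close>

definition gauss_density :: "nat \<Rightarrow> (nat \<Rightarrow> real) \<times> (nat \<Rightarrow> real) \<Rightarrow> real" where
  "gauss_density d v = (1 / sqrt (2 * pi)) ^ (2 * d) * exp (- ((\<Sum>i<d. (fst v i)\<^sup>2) + (\<Sum>i<d. (snd v i)\<^sup>2)) / 2)"

lemma gauss_density_nonneg: "0 \<le> gauss_density d v"
  by (simp add: gauss_density_def)

lemma measurable_gauss_density[measurable]: "gauss_density d \<in> borel_measurable (leb d \<Otimes>\<^sub>M leb d)"
  unfolding gauss_density_def by measurable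

lemma prod_std_normal_density:
  "(\<Prod>i<d. ennreal (std_normal_density (z i))) = ennreal ((1 / sqrt (2 * pi)) ^ d * exp (- (\<Sum>i<d. (z i)\<^sup>2) / 2))"
proof -
  have "(\<Prod>i<d. std_normal_density (z i)) = (1 / sqrt (2 * pi)) ^ d * (\<Prod>i<d. exp (- (z i)\<^sup>2 / 2))"
    unfolding std_normal_density_def prod.distrib by simp
  also have "(\<Prod>i<d. exp (- (z i)\<^sup>2 / 2)) = exp (- (\<Sum>i<d. (z i)\<^sup>2) / 2)"
    by (simp add: exp_sum[symmetric] sum_negf sum_divide_distrib)
  finally show ?thesis by (simp add: prod_ennreal)
qed

lemma std_gauss_pair_eq_density:
  "std_gauss d \<Otimes>\<^sub>M std_gauss d = density (leb d \<Otimes>\<^sub>M leb d) (gauss_density d)"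
proof -
  have "sigma_finite_measure (std_gauss d)"
    using prob_space_std_gauss by (rule prob_space_imp_sigma_finite)
  then have "std_gauss d \<Otimes>\<^sub>M std_gauss d = density (leb d \<Otimes>\<^sub>M leb d)
      (\<lambda>(z, w). (\<Prod>i<d. ennreal (std_normal_density (z i))) * (\<Prod>i<d. ennreal (std_normal_density (w i))))"
    unfolding std_gauss_eq_density by (intro pair_measure_density sigma_finite_leb) auto
  also have "(\<lambda>(z, w). (\<Prod>i<d. ennreal (std_normal_density (z i))) * (\<Prod>i<d. ennreal (std_normal_density (w i))))
      = gauss_density d"
  proof (intro ext)
    fix v :: "(nat \<Rightarrow> real) \<times> (nat \<Rightarrow> real)"
    obtain z w where v: "v = (z, w)" by fastforce
    have "exp (- ((\<Sum>i<d. (z i)\<^sup>2) + (\<Sum>i<d. (w i)\<^sup>2)) / 2)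
        = exp (- (\<Sum>i<d. (z i)\<^sup>2) / 2) * exp (- (\<Sum>i<d. (w i)\<^sup>2) / 2)"
      unfolding exp_add[symmetric] by (simp add: diff_divide_distrib)
    then show "(case v of (z, w) \<Rightarrow> (\<Prod>i<d. ennreal (std_normal_density (z i))) * (\<Prod>i<d. ennreal (std_normal_density (w i))))
        = ennreal (gauss_density d v)"
      unfolding v prod.case prod_std_normal_density gauss_density_def mult_2 power_add fst_conv snd_conv
      by (subst ennreal_mult[symmetric]) (simp_all add: mult_ac)
  qed
  finally show ?thesis .
qed

section \<open>Exponential and fourth moments of Gaussian linear forms\<close>

lemma nn_integral_exp_std_normal:
  "(\<integral>\<^sup>+x. exp (a * x) \<partial>density lborel std_normal_density) = exp (a\<^sup>2 / 2)"
proof -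
  have "(\<integral>\<^sup>+x. exp (a * x) \<partial>density lborel std_normal_density)
      = (\<integral>\<^sup>+x. ennreal (std_normal_density x) * ennreal (exp (a * x)) \<partial>lborel)"
    by (rule nn_integral_density) auto
  also have "\<dots> = (\<integral>\<^sup>+x. ennreal (exp (a\<^sup>2 / 2)) * ennreal (normal_density a 1 x) \<partial>lborel)"
  proof (intro nn_integral_cong)
    fix x :: real
    \<comment> \<open>Completing the square: the tilted density is a multiple of the normal density
      with mean a.\<close>
    have "- x\<^sup>2 / 2 + a * x = a\<^sup>2 / 2 + - (x - a)\<^sup>2 / 2" by (simp add: power2_eq_square field_simps)
    then have "exp (- x\<^sup>2 / 2) * exp (a * x) = exp (a\<^sup>2 / 2) * exp (- (x - a)\<^sup>2 / 2)"
      by (simp only: exp_add[symmetric])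
    then have "std_normal_density x * exp (a * x) = exp (a\<^sup>2 / 2) * normal_density a 1 x"
      unfolding normal_density_def by simp
    then show "ennreal (std_normal_density x) * ennreal (exp (a * x)) = ennreal (exp (a\<^sup>2 / 2)) * ennreal (normal_density a 1 x)"
      by (simp flip: ennreal_mult)
  qed
  also have "\<dots> = ennreal (exp (a\<^sup>2 / 2)) * (\<integral>\<^sup>+x. ennreal (normal_density a 1 x) \<partial>lborel)"
    by (rule nn_integral_cmult) auto
  also have "(\<integral>\<^sup>+x. ennreal (normal_density a 1 x) \<partial>lborel) = 1"
    by (subst nn_integral_eq_integral) auto
  finally show ?thesis by simp
qed

lemma nn_integral_exp_std_gauss:
  "(\<integral>\<^sup>+z. exp (\<Sum>i<d. a i * z i) \<partial>std_gauss d) = exp ((\<Sum>i<d. (a i)\<^sup>2) / 2)"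
proof -
  interpret G: product_prob_space "\<lambda>_::nat. density lborel std_normal_density"
    by (intro product_prob_spaceI prob_space_normal_density) simp
  have "(\<integral>\<^sup>+z. exp (\<Sum>i<d. a i * z i) \<partial>std_gauss d) = (\<integral>\<^sup>+z. (\<Prod>i<d. ennreal (exp (a i * z i))) \<partial>std_gauss d)"
    by (simp add: exp_sum prod_ennreal)
  also have "\<dots> = (\<Prod>i<d. \<integral>\<^sup>+x. ennreal (exp (a i * x)) \<partial>density lborel std_normal_density)"
    unfolding std_gauss_def by (rule G.product_nn_integral_prod) auto
  also have "\<dots> = exp ((\<Sum>i<d. (a i)\<^sup>2) / 2)"
    by (simp add: nn_integral_exp_std_normal prod_ennreal exp_sum[symmetric] sum_divide_distrib)
  finally show ?thesis .
qed

lemma nn_integral_exp_std_gauss_pair: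
  "(\<integral>\<^sup>+v. exp ((\<Sum>i<d. a i * fst v i) + (\<Sum>i<d. b i * snd v i)) \<partial>(std_gauss d \<Otimes>\<^sub>M std_gauss d))
    = exp (((\<Sum>i<d. (a i)\<^sup>2) + (\<Sum>i<d. (b i)\<^sup>2)) / 2)"
proof -
  interpret prob_space "std_gauss d" by (rule prob_space_std_gauss)
  have "(\<integral>\<^sup>+v. exp ((\<Sum>i<d. a i * fst v i) + (\<Sum>i<d. b i * snd v i)) \<partial>(std_gauss d \<Otimes>\<^sub>M std_gauss d))
    = (\<integral>\<^sup>+z. \<integral>\<^sup>+w. ennreal (exp (\<Sum>i<d. a i * z i)) * ennreal (exp (\<Sum>i<d. b i * w i)) \<partial>std_gauss d \<partial>std_gauss d)"
    by (subst nn_integral_fst[symmetric]) (auto simp: exp_add ennreal_mult)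
  also have "\<dots> = (\<integral>\<^sup>+z. ennreal (exp (\<Sum>i<d. a i * z i)) * ennreal (exp ((\<Sum>i<d. (b i)\<^sup>2) / 2)) \<partial>std_gauss d)"
    by (subst nn_integral_cmult) (auto simp: nn_integral_exp_std_gauss)
  also have "\<dots> = ennreal (exp ((\<Sum>i<d. (a i)\<^sup>2) / 2)) * ennreal (exp ((\<Sum>i<d. (b i)\<^sup>2) / 2))"
    by (subst nn_integral_multc) (auto simp: nn_integral_exp_std_gauss)
  also have "\<dots> = exp (((\<Sum>i<d. (a i)\<^sup>2) + (\<Sum>i<d. (b i)\<^sup>2)) / 2)"
    by (simp add: ennreal_mult[symmetric] exp_add[symmetric] add_divide_distrib)
  finally show ?thesis .
qed

text \<open>The fourth power of y/4 <= exp (y/4), with 256 = 4^4. It lets exponential moments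
  control the fourth moment.\<close>

lemma power4_le_exp: "(x::real) ^ 4 \<le> 256 * (exp x + exp (- x))"
proof -
  have "y ^ 4 \<le> 256 * exp y" if "y \<ge> 0" for y :: real
  proof -
    have "y / 4 \<le> exp (y / 4)" using exp_ge_add_one_self[of "y / 4"] by linarith
    then have "(y / 4) ^ 4 \<le> exp (y / 4) ^ 4" using that by (intro power_mono) auto
    also have "\<dots> = exp y" by (simp flip: exp_of_nat_mult)
    finally show ?thesis by (simp add: power_divide)
  qed
  from this[of "\<bar>x\<bar>"] have "x ^ 4 \<le> 256 * exp \<bar>x\<bar>" by simp
  also have "\<dots> \<le> 256 * (exp x + exp (- x))" by (auto simp: abs_if)
  finally show ?thesis .
qed

lemma nn_integral_power4_std_gauss_pair:
  fixes a b :: "nat \<Rightarrow> real" and d :: nat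
  defines "v2 \<equiv> (\<Sum>i<d. (a i)\<^sup>2) + (\<Sum>i<d. (b i)\<^sup>2)"
  assumes pos: "0 < v2"
  shows "(\<integral>\<^sup>+v. ennreal (((\<Sum>i<d. a i * fst v i) + (\<Sum>i<d. b i * snd v i)) ^ 4) \<partial>(std_gauss d \<Otimes>\<^sub>M std_gauss d))
    \<le> ennreal (512 * exp (1 / 2) * v2\<^sup>2)"
proof -
  define t where "t v = (\<Sum>i<d. a i * fst v i) + (\<Sum>i<d. b i * snd v i)" for v :: "(nat \<Rightarrow> real) \<times> (nat \<Rightarrow> real)"
  let ?M = "std_gauss d \<Otimes>\<^sub>M std_gauss d"
  have E: "(\<integral>\<^sup>+v. ennreal (exp (c * t v)) \<partial>?M) = exp (c\<^sup>2 * v2 / 2)" for c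
    using nn_integral_exp_std_gauss_pair[where a="\<lambda>i. c * a i" and b="\<lambda>i. c * b i" and d=d]
    by (simp add: t_def v2_def distrib_left sum_distrib_left power_mult_distrib mult.assoc)
  \<comment> \<open>Normalises the linear form to unit variance, so that both exponential moments
    equal exp (1/2). Only the order \<open>v2\<^sup>2\<close> of the bound matters.\<close>
  define s where "s = 1 / sqrt v2"
  have s2: "s\<^sup>2 * v2 = 1" "s ^ 4 * v2\<^sup>2 = 1" using pos
    by (simp_all add: s_def power_divide power4_eq_xxxx power2_eq_square flip: mult.assoc)
  have [measurable]: "t \<in> borel_measurable ?M" unfolding t_def by measurable
  have "t v ^ 4 \<le> 256 * v2\<^sup>2 * exp (s * t v) + 256 * v2\<^sup>2 * exp ((- s) * t v)" for v
  proof -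
    have "t v ^ 4 = v2\<^sup>2 * (s * t v) ^ 4" using s2(2) by (simp add: power_mult_distrib mult_ac)
    also have "\<dots> \<le> v2\<^sup>2 * (256 * (exp (s * t v) + exp (- (s * t v))))"
      by (intro mult_left_mono power4_le_exp) simp
    finally show ?thesis by (simp add: algebra_simps)
  qed
  then have "(\<integral>\<^sup>+v. ennreal (t v ^ 4) \<partial>?M)
    \<le> (\<integral>\<^sup>+v. ennreal (256 * v2\<^sup>2) * ennreal (exp (s * t v)) + ennreal (256 * v2\<^sup>2) * ennreal (exp ((- s) * t v)) \<partial>?M)"
    by (intro nn_integral_mono) (simp add: ennreal_mult[symmetric] ennreal_plus[symmetric] del: ennreal_plus)
  also have "\<dots> = ennreal (256 * v2\<^sup>2) * ennreal (exp (1 / 2)) + ennreal (256 * v2\<^sup>2) * ennreal (exp (1 / 2))"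
    by (subst nn_integral_add, simp, simp, subst (1 2) nn_integral_cmult)
      (simp_all only: E s2 power2_minus, auto)
  also have "\<dots> = ennreal (512 * exp (1 / 2) * v2\<^sup>2)"
    by (simp add: ennreal_mult[symmetric] ennreal_plus[symmetric] del: ennreal_plus)
  finally show ?thesis by (simp add: t_def)
qed

subsection \<open>The walk over the good signs\<close>

text \<open>The form in which independence of the signs is used: a weighted sum over all sign
  patterns factors over the coordinates.\<close>

lemma sum_Pow_prod_if:
  fixes f g :: "'a \<Rightarrow> 'b::comm_semiring_1"
  assumes "finite A"
  shows "(\<Sum>X\<in>Pow A. \<Prod>i\<in>A. if i \<in> X then f i else g i) = (\<Prod>i\<in>A. f i + g i)"
  unfolding prod_add[OF assms]
proof (intro sum.cong refl)
  fix X assume "X \<in> Pow A"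
  then have "A \<inter> {x. x \<in> X} = X" "A \<inter> - {x. x \<in> X} = A - X" by auto
  then show "(\<Prod>i\<in>A. if i \<in> X then f i else g i) = (\<Prod>x\<in>X. f x) * (\<Prod>x\<in>A - X. g x)"
    by (simp add: prod.If_cases[OF assms])
qed

text \<open>Bad positions contribute no step. The constants are chosen later so that the exponential
  of the walk contracts on average at each good step.\<close>

definition good_walk :: "real \<Rightarrow> real \<Rightarrow> (nat \<Rightarrow> bool) \<Rightarrow> (nat \<Rightarrow> bool) \<Rightarrow> nat \<Rightarrow> real" where
  "good_walk \<theta> \<tau> good half m = (\<Sum>j | j < m \<and> good j. if half j then \<theta> else - \<tau>)"

lemma sum_Collect_Suc:
  "sum f {j. j < Suc m \<and> P j} = sum f {j. j < m \<and> P j} + (if P m then f m else 0)"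
proof -
  have "{j. j < Suc m \<and> P j} = (if P m then insert m {j. j < m \<and> P j} else {j. j < m \<and> P j})"
    by (auto simp: less_Suc_eq)
  then show ?thesis by (simp add: add.commute)
qed

text \<open>The walk at m is 0 or its value just after the last good step, and x <= exp x. Adding
  the other positive terms gives a bound that can be used at the data-dependent index
  \<open>k_hat\<close>.\<close>

lemma good_walk_le_sum_exp:
  "good_walk \<theta> \<tau> good half m \<le> (\<Sum>j | j < m \<and> good j. exp (good_walk \<theta> \<tau> good half (Suc j)))"
proof (induction m)
  case 0
  then show ?case by (simp add: good_walk_def)
next
  case (Suc m)
  show ?case
  proof (cases "good m")
    case True
    have "good_walk \<theta> \<tau> good half (Suc m) \<le> exp (good_walk \<theta> \<tau> good half (Suc m))"
      using exp_ge_add_one_self[of "good_walk \<theta> \<tau> good half (Suc m)"] by linarith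
    also have "\<dots> \<le> (\<Sum>j | j < m \<and> good j. exp (good_walk \<theta> \<tau> good half (Suc j))) + exp (good_walk \<theta> \<tau> good half (Suc m))"
      by (simp add: sum_nonneg)
    finally show ?thesis using True by (simp add: sum_Collect_Suc)
  next
    case False
    then have "good_walk \<theta> \<tau> good half (Suc m) = good_walk \<theta> \<tau> good half m"
      by (simp add: good_walk_def sum_Collect_Suc)
    with Suc False show ?thesis by (simp add: sum_Collect_Suc)
  qed
qed

text \<open>At the stopping index 1 + N <= \<alpha> P, where P matches and N mismatches have
  occurred. All but card Bad matches are good, so the walk there is at least (\<theta> - \<tau>
  \<alpha>) P - \<theta> card Bad. Extending the sum of exponentials to all d positions then removes
  the dependence on \<open>k_hat\<close>.\<close>

lemma n_rej_le_walk:
  assumes perm: "bij_betw perm {..<d} {..<d}" and const: "0 \<le> \<theta>" "0 \<le> \<tau>" "0 \<le> \<alpha>"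
    and Bad: "Bad \<subseteq> {..<d}"
  shows "(\<theta> - \<tau> * \<alpha>) * real (n_rej \<alpha> d bt perm \<psi>) \<le> \<theta> * real (card Bad) +
    (\<Sum>j | j < d \<and> perm j \<notin> Bad. exp (good_walk \<theta> \<tau> (\<lambda>j. perm j \<notin> Bad) (half_p bt perm \<psi>) (Suc j)))"
    (is "_ \<le> _ + sum ?e _")
proof -
  define K where "K = k_hat \<alpha> d bt perm \<psi>"
  let ?half = "half_p bt perm \<psi>" and ?good = "\<lambda>j. perm j \<notin> Bad"
  let ?P = "{j. j < K \<and> ?half j}" and ?N = "{j. j < K \<and> \<not> ?half j}"
  have R: "n_rej \<alpha> d bt perm \<psi> = card ?P" by (simp add: n_rej_def K_def)
  have finBad: "finite Bad" using Bad finite_subset by blast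
  show ?thesis
  proof (cases "\<exists>k\<in>{1..d}. fdp_hat bt perm \<psi> k \<le> ereal \<alpha>")
    case False
    then have "K = 0" by (simp add: K_def k_hat_def)
    then show ?thesis using const by (simp add: R sum_nonneg)
  next
    case True
    let ?A = "{k \<in> {1..d}. fdp_hat bt perm \<psi> k \<le> ereal \<alpha>}"
    have "K = Max ?A" using True by (simp add: K_def k_hat_def)
    moreover have "Max ?A \<in> ?A" using True by (intro Max_in) auto
    ultimately have K: "K \<le> d" "fdp_hat bt perm \<psi> K \<le> ereal \<alpha>" by auto
    \<comment> \<open>With no match the estimated FDP is infinite, which a selected index rules
      out.\<close>
    have P0: "card ?P \<noteq> 0"
    proof
      assume "card ?P = 0"
      with K(2) show False by (simp add: fdp_hat_def)
    qed
    with K(2) have "(1 + real (card ?N)) / real (card ?P) \<le> \<alpha>"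
      by (simp add: fdp_hat_def del: card_eq_0_iff)
    with P0 have PN: "1 + real (card ?N) \<le> \<alpha> * real (card ?P)"
      by (subst (asm) pos_divide_le_eq) (simp_all only: of_nat_0_less_iff neq0_conv)
    let ?PG = "{j. j < K \<and> ?good j \<and> ?half j}" and ?NG = "{j. j < K \<and> ?good j \<and> \<not> ?half j}"
    have walk: "good_walk \<theta> \<tau> ?good ?half K = \<theta> * real (card ?PG) - \<tau> * real (card ?NG)"
    proof -
      have eq: "{j. j < K \<and> ?good j} \<inter> {j. ?half j} = ?PG" "{j. j < K \<and> ?good j} \<inter> - {j. ?half j} = ?NG" by auto
      show ?thesis unfolding good_walk_def by (simp add: sum.If_cases eq)
    qed
    have "card ?P \<le> card ?PG + card Bad"
    proof -
      have "card ?P \<le> card (?PG \<union> {j. j < K \<and> perm j \<in> Bad})" by (intro card_mono) auto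
      also have "\<dots> \<le> card ?PG + card {j. j < K \<and> perm j \<in> Bad}" by (rule card_Un_le)
      also have "card {j. j < K \<and> perm j \<in> Bad} \<le> card Bad"
      proof (rule card_inj_on_le)
        show "inj_on perm {j. j < K \<and> perm j \<in> Bad}"
          using bij_betw_imp_inj_on[OF perm] by (rule inj_on_subset) (use K in auto)
      qed (auto simp: finBad)
      finally show ?thesis by simp
    qed
    then have 1: "\<theta> * real (card ?P) \<le> \<theta> * (real (card ?PG) + real (card Bad))"
      using const by (intro mult_left_mono) linarith+
    have "card ?NG \<le> card ?N" by (intro card_mono) auto
    then have "\<tau> * real (card ?NG) \<le> \<tau> * (\<alpha> * real (card ?P))"
      using const PN by (intro mult_left_mono) linarith+
    with 1 have "(\<theta> - \<tau> * \<alpha>) * real (card ?P) \<le> \<theta> * real (card Bad) + good_walk \<theta> \<tau> ?good ?half K"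
      unfolding walk by (simp add: algebra_simps)
    also have "good_walk \<theta> \<tau> ?good ?half K \<le> sum ?e {j. j < K \<and> ?good j}"
      by (rule good_walk_le_sum_exp)
    also have "\<dots> \<le> sum ?e {j. j < d \<and> ?good j}"
      using K(1) by (intro sum_mono2) auto
    finally show ?thesis by (simp add: R)
  qed
qed

text \<open>Along the good positions the exponents are 1, 2, 3, and so on, so this is a geometric
  sum.\<close>

lemma sum_power_card_le:
  fixes q :: real
  assumes "0 \<le> q" "q < 1"
  shows "(\<Sum>j | j < m \<and> good j. q ^ card {i. i < Suc j \<and> good i}) \<le> 1 / (1 - q)"
proof -
  have card_Suc: "card {i. i < Suc j \<and> good i} = card {i. i < j \<and> good i} + (if good j then 1 else 0)" for j
    unfolding card_eq_sum by (rule sum_Collect_Suc)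
  have "(1 - q) * (\<Sum>j | j < m \<and> good j. q ^ card {i. i < Suc j \<and> good i}) \<le> 1 - q ^ card {i. i < m \<and> good i}"
  proof (induction m)
    case (Suc m)
    show ?case
    proof (cases "good m")
      case True
      let ?n = "card {i. i < m \<and> good i}"
      have "(1 - q) * q ^ Suc ?n \<le> q ^ ?n - q ^ Suc ?n"
      proof -
        have "0 \<le> (1 - q) * (1 - q) * q ^ ?n" using assms by simp
        then show ?thesis by (simp add: algebra_simps)
      qed
      with Suc True show ?thesis by (simp add: sum_Collect_Suc card_Suc distrib_left)
    next
      case False
      then show ?thesis using Suc by (simp add: sum_Collect_Suc card_Suc)
    qed
  qed simp
  also have "\<dots> \<le> 1" using assms by simp
  finally show ?thesis using assms by (simp add: field_simps)
qed

text \<open>Whichever of the two outcomes, weighted \<open>e\<close> and \<open>1\<close>, is a match, the odds of a match are at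
  most \<open>c\<close>.\<close>
lemma two_point_average_le:
  fixes c e \<theta> \<tau> :: real
  assumes "0 < c" "0 < e" "e \<le> c" "1 \<le> c * e" "0 \<le> \<theta>" "0 \<le> \<tau>" "\<not> (H1 \<and> H0)"
  shows "e * (if H1 then exp \<theta> else exp (- \<tau>)) + (if H0 then exp \<theta> else exp (- \<tau>))
    \<le> (c * exp \<theta> + exp (- \<tau>)) / (1 + c) * (1 + e)"
proof -
  define X where "X = exp \<theta>"
  define Y where "Y = exp (- \<tau>)"
  have XY: "Y \<le> X" "0 < Y" using assms by (auto simp: X_def Y_def)
  have *: "(e * (if H1 then X else Y) + (if H0 then X else Y)) * (1 + c) \<le> (c * X + Y) * (1 + e)"
  proof -
    \<comment> \<open>The differences of the two sides when the match is the first outcome, the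
      second outcome, or neither.\<close>
    have "0 \<le> (c - e) * (X - Y)" "0 \<le> (c * e - 1) * (X - Y)" "0 \<le> c * (1 + e) * (X - Y)"
      using assms XY by auto
    then show ?thesis using assms(7) by (cases H1; cases H0) (auto simp: algebra_simps)
  qed
  have "e * (if H1 then X else Y) + (if H0 then X else Y) \<le> (c * X + Y) * (1 + e) / (1 + c)"
    using * assms(1) by (subst pos_le_divide_eq) auto
  then show ?thesis unfolding X_def Y_def by simp
qed

text \<open>The bound conditional on \<xi> and the absolute values: order and signs
  \<open>\<psi>\<close> are fixed, J runs over the sign patterns, and the product of
  \<open>e\<close> over J is the unnormalised probability of the pattern J. The mean exponential of
  the walk after n good steps is at most q^n, and these means form a geometric sum.\<close>

lemma flip_average_n_rej_le:
  fixes c \<theta> \<tau> \<alpha> :: real and e bt \<psi> :: "nat \<Rightarrow> real"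
  defines "q \<equiv> (c * exp \<theta> + exp (- \<tau>)) / (1 + c)"
  assumes perm: "bij_betw perm {..<d} {..<d}" and psi: "\<And>i. i < d \<Longrightarrow> \<psi> i \<in> {-1, 1}"
    and const: "0 < c" "0 \<le> \<theta>" "0 \<le> \<tau>" "0 \<le> \<alpha>" "q < 1" and Bad: "Bad \<subseteq> {..<d}"
    and e: "\<And>i. i < d \<Longrightarrow> 0 < e i" "\<And>i. i < d \<Longrightarrow> i \<notin> Bad \<Longrightarrow> e i \<le> c \<and> 1 \<le> c * e i"
  shows "(\<Sum>J\<in>Pow {..<d}. (\<Prod>i\<in>J. e i) * ((\<theta> - \<tau> * \<alpha>) * real (n_rej \<alpha> d (\<lambda>i. if i \<in> J then - bt i else bt i) perm \<psi>)))
    \<le> (\<theta> * real (card Bad) + 1 / (1 - q)) * (\<Sum>J\<in>Pow {..<d}. \<Prod>i\<in>J. e i)"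
proof -
  let ?I = "{..<d}"
  let ?good = "\<lambda>j. perm j \<notin> Bad"
  define btJ where "btJ J i = (if i \<in> J then - bt i else bt i)" for J i
  define W where "W J = (\<Prod>i\<in>J. e i)" for J
  define E where "E J j = exp (good_walk \<theta> \<tau> ?good (half_p (btJ J) perm \<psi>) (Suc j))" for J j
  have q0: "0 \<le> q" using const by (simp add: q_def)
  have W_if: "W J = (\<Prod>i<d. if i \<in> J then e i else 1)" if "J \<in> Pow ?I" for J
    using that unfolding W_def by (simp add: prod.If_cases Int_absorb1)
  have W0: "0 \<le> W J" if "J \<in> Pow ?I" for J
    using that e(1) unfolding W_def by (intro prod_nonneg) (auto intro: less_imp_le)
  have sumW: "(\<Sum>J\<in>Pow ?I. W J) = (\<Prod>i<d. e i + 1)"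
    by (simp add: W_if sum_Pow_prod_if)
  have avg: "(\<Sum>J\<in>Pow ?I. W J * E J j) \<le> q ^ card {i. i < Suc j \<and> ?good i} * (\<Sum>J\<in>Pow ?I. W J)"
    if j: "j < d" for j
  proof -
    define C where "C = perm ` {i. i < Suc j \<and> ?good i}"
    have inj: "inj_on perm {i. i < Suc j \<and> ?good i}"
      using bij_betw_imp_inj_on[OF perm] by (rule inj_on_subset) (use j in auto)
    have C: "C \<subseteq> ?I" "C \<inter> Bad = {}" "card C = card {i. i < Suc j \<and> ?good i}"
      using bij_betw_imp_surj_on[OF perm] j card_image[OF inj] by (auto simp: C_def)
    \<comment> \<open>Factor contributed by variable i to the exponential of the walk; b tells
      whether its sign is flipped.\<close>
    define h where "h b i = (if sgn (if b then - bt i else bt i) = \<psi> i then exp \<theta> else exp (- \<tau>))" for b i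
    have E_eq: "E J j = (\<Prod>i<d. if i \<in> C then h (i \<in> J) i else 1)" for J
    proof -
      have "E J j = (\<Prod>i | i < Suc j \<and> ?good i. exp (if half_p (btJ J) perm \<psi> i then \<theta> else - \<tau>))"
        unfolding E_def good_walk_def by (simp add: exp_sum)
      also have "\<dots> = (\<Prod>i | i < Suc j \<and> ?good i. h (perm i \<in> J) (perm i))"
        by (intro prod.cong refl) (simp add: h_def half_p_def btJ_def)
      also have "\<dots> = (\<Prod>i\<in>C. h (i \<in> J) i)" unfolding C_def by (simp add: prod.reindex[OF inj])
      also have "\<dots> = (\<Prod>i<d. if i \<in> C then h (i \<in> J) i else 1)"
        using C(1) by (simp add: prod.If_cases Int_absorb1)
      finally show ?thesis .
    qed
    have "(\<Sum>J\<in>Pow ?I. W J * E J j)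
        = (\<Sum>J\<in>Pow ?I. \<Prod>i<d. if i \<in> J then e i * (if i \<in> C then h True i else 1) else (if i \<in> C then h False i else 1))"
      by (intro sum.cong refl) (auto simp: W_if E_eq prod.distrib[symmetric] intro!: prod.cong)
    also have "\<dots> = (\<Prod>i<d. e i * (if i \<in> C then h True i else 1) + (if i \<in> C then h False i else 1))"
      by (rule sum_Pow_prod_if) simp
    \<comment> \<open>Each good variable visited so far contributes a factor q relative to its total
      weight e i + 1; the other variables contribute exactly their weight.\<close>
    also have "\<dots> \<le> (\<Prod>i<d. (if i \<in> C then q else 1) * (e i + 1))"
    proof (intro prod_mono conjI)
      fix i assume i: "i \<in> ?I"
      show "0 \<le> e i * (if i \<in> C then h True i else 1) + (if i \<in> C then h False i else 1)"
        using e(1)[of i] i by (auto simp: h_def intro!: add_nonneg_nonneg mult_nonneg_nonneg)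
      show "e i * (if i \<in> C then h True i else 1) + (if i \<in> C then h False i else 1) \<le> (if i \<in> C then q else 1) * (e i + 1)"
      proof (cases "i \<in> C")
        case True
        then have "i \<notin> Bad" using C(2) by auto
        then have ei: "e i \<le> c" "1 \<le> c * e i" using e(2) i by auto
        have "\<psi> i \<noteq> 0" using psi[of i] i by auto
        \<comment> \<open>At most one of the two signs is a match, and neither is if the coordinate
          is 0.\<close>
        then have "\<not> (sgn (- bt i) = \<psi> i \<and> sgn (bt i) = \<psi> i)" by (auto simp: sgn_minus)
        from two_point_average_le[OF const(1) e(1)[of i] ei const(2,3) this] i True
        show ?thesis by (simp add: h_def q_def add.commute)
      qed simp
    qed
    also have "\<dots> = q ^ card C * (\<Sum>J\<in>Pow ?I. W J)"
      using C(1) by (simp add: prod.distrib sumW prod.If_cases Int_absorb1)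
    finally show ?thesis by (simp add: C(3))
  qed
  have "(\<Sum>J\<in>Pow ?I. W J * ((\<theta> - \<tau> * \<alpha>) * real (n_rej \<alpha> d (btJ J) perm \<psi>)))
      \<le> (\<Sum>J\<in>Pow ?I. W J * (\<theta> * real (card Bad) + (\<Sum>j | j < d \<and> ?good j. E J j)))"
    unfolding E_def by (intro sum_mono mult_left_mono n_rej_le_walk W0) (use perm const Bad in auto)
  also have "\<dots> = \<theta> * real (card Bad) * (\<Sum>J\<in>Pow ?I. W J) + (\<Sum>j | j < d \<and> ?good j. \<Sum>J\<in>Pow ?I. W J * E J j)"
    by (subst sum.swap[of _ "Pow ?I"]) (simp add: distrib_left sum.distrib sum_distrib_left sum_distrib_right mult.commute)
  also have "(\<Sum>j | j < d \<and> ?good j. \<Sum>J\<in>Pow ?I. W J * E J j)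
      \<le> (\<Sum>j | j < d \<and> ?good j. q ^ card {i. i < Suc j \<and> ?good i} * (\<Sum>J\<in>Pow ?I. W J))"
    by (intro sum_mono avg) auto
  also have "\<dots> = (\<Sum>j | j < d \<and> ?good j. q ^ card {i. i < Suc j \<and> ?good i}) * (\<Sum>J\<in>Pow ?I. W J)"
    by (simp add: sum_distrib_right)
  also have "\<dots> \<le> 1 / (1 - q) * (\<Sum>J\<in>Pow ?I. W J)"
    by (intro mult_right_mono sum_power_card_le sum_nonneg W0 q0 const)
  finally show ?thesis by (simp add: W_def btJ_def distrib_right)
qed

text \<open>To first order in \<open>\<epsilon>\<close> the two conditions on \<open>\<theta> = \<alpha> powr (3/4) * \<epsilon>\<close> and \<open>\<tau> = \<epsilon>\<close> read
  \<open>\<alpha> < \<alpha> powr (3/4)\<close> and \<open>\<alpha> powr (-1/2) * \<alpha> powr (3/4) < 1\<close>.\<close>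
lemma walk_constants:
  fixes \<alpha> :: real
  assumes "0 < \<alpha>" "\<alpha> < 1"
  defines "c \<equiv> \<alpha> powr (-1/2)"
  shows "\<exists>\<theta> \<tau>. 0 < \<theta> \<and> 0 < \<tau> \<and> 0 < \<theta> - \<tau> * \<alpha> \<and> (c * exp \<theta> + exp (- \<tau>)) / (1 + c) < 1"
proof -
  define r where "r = \<alpha> powr (3/4)"
  have r: "\<alpha> < r" "0 < r"
    using assms powr_less_mono'[of \<alpha> "3/4" 1] by (simp_all add: r_def)
  have c: "0 < c" using assms by (simp add: c_def)
  have cr: "c * r < 1"
    using assms(1,2) powr_less_mono'[of \<alpha> 0 "1/4"] by (simp add: c_def r_def powr_add[symmetric])
  \<comment> \<open>f x < 0 rearranges the contraction condition at \<theta> = r x and \<tau> = x.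
    Since f 0 = 0, a negative slope c r - 1 at 0 yields a suitable x.\<close>
  define f where "f x = c * (exp (r * x) - 1) - (1 - exp (- x))" for x :: real
  have "(f has_real_derivative c * r - 1) (at 0)"
    unfolding f_def by (auto intro!: derivative_eq_intros)
  then obtain h where h: "h > 0" "\<And>y. 0 < y \<Longrightarrow> y < h \<Longrightarrow> f (0 + y) < f 0"
    using DERIV_neg_dec_right[of f "c * r - 1" 0] cr by auto
  define x where "x = h / 2"
  have x: "0 < x" "f x < 0" using h(1) h(2)[of x] by (auto simp: x_def f_def)
  have "0 < r * x" "0 < r * x - x * \<alpha>" using x r by (auto simp: algebra_simps)
  moreover have "(c * exp (r * x) + exp (- x)) / (1 + c) < 1"
    using x(2) c by (simp add: f_def field_simps)
  ultimately show ?thesis using x(1) by blast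
qed

subsection \<open>Sign flips of the noisy estimate\<close>

lemma sum_mult_add_comb:
  fixes a x :: "nat \<Rightarrow> real" and d :: nat
  shows "(\<Sum>l<d. a l * (x l + (\<Sum>i\<in>J. c i * b i l))) = (\<Sum>l<d. a l * x l) + (\<Sum>i\<in>J. c i * (\<Sum>l<d. a l * b i l))"
proof -
  have "(\<Sum>l<d. \<Sum>i\<in>J. a l * (c i * b i l)) = (\<Sum>i\<in>J. \<Sum>l<d. a l * (c i * b i l))" by (rule sum.swap)
  then show ?thesis by (simp add: distrib_left sum.distrib sum_distrib_left mult_ac)
qed

locale whitening =
  fixes d :: nat and S :: "nat \<Rightarrow> nat \<Rightarrow> real" and \<beta> :: "nat \<Rightarrow> real" and \<sigma> :: real
    and \<delta> :: "nat \<Rightarrow> real" and A B :: "nat \<Rightarrow> nat \<Rightarrow> real"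
  assumes pos_def: "pos_def d S" and sigma_pos: "0 < \<sigma>" and loewner: "loewner_ge d (diag_mat \<delta>) S"
    and AAT: "\<forall>i<d. \<forall>j<d. mat_mult_transp d A i j = S i j"
    and BBT: "\<forall>i<d. \<forall>j<d. mat_mult_transp d B i j = diag_mat \<delta> i j - S i j"
begin

lemma delta_pos: "i < d \<Longrightarrow> 0 < \<delta> i"
  by (rule loewner_diag_pos[OF pos_def loewner])

definition noise :: "(nat \<Rightarrow> real) \<times> (nat \<Rightarrow> real) \<Rightarrow> nat \<Rightarrow> real" where
  "noise v i = (\<Sum>l<d. A i l * fst v l) + (\<Sum>l<d. B i l * snd v l)"

definition bt :: "(nat \<Rightarrow> real) \<times> (nat \<Rightarrow> real) \<Rightarrow> nat \<Rightarrow> real" where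
  "bt v i = \<beta> i + \<sigma> * noise v i"

text \<open>The multiple of the i-th row of [A | B] that must be added to (z, w) to negate
  coordinate i of \<open>bt\<close>.\<close>

definition coef :: "(nat \<Rightarrow> real) \<times> (nat \<Rightarrow> real) \<Rightarrow> nat \<Rightarrow> real" where
  "coef v i = - 2 * bt v i / (\<sigma> * \<delta> i)"

text \<open>The composition of the reflections in the hyperplanes where \<open>bt\<close> vanishes
  in coordinate i, for i in J. Taking all coefficients at the original point is correct because the
  rows are orthogonal.\<close>

definition flip :: "nat set \<Rightarrow> (nat \<Rightarrow> real) \<times> (nat \<Rightarrow> real) \<Rightarrow> (nat \<Rightarrow> real) \<times> (nat \<Rightarrow> real)" where
  "flip J v = (\<lambda>l\<in>{..<d}. fst v l + (\<Sum>i\<in>J. coef v i * A i l), \<lambda>l\<in>{..<d}. snd v l + (\<Sum>i\<in>J. coef v i * B i l))"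

text \<open>Logarithm of the Gaussian density at v relative to that at v with coordinate i of
  \<open>bt\<close> flipped.\<close>

definition log_odds :: "(nat \<Rightarrow> real) \<times> (nat \<Rightarrow> real) \<Rightarrow> nat \<Rightarrow> real" where
  "log_odds v i = 2 * \<beta> i * bt v i / (\<sigma>\<^sup>2 * \<delta> i)"

lemma measurable_noise[measurable]: "(\<lambda>v. noise v i) \<in> borel_measurable (leb d \<Otimes>\<^sub>M leb d)"
  unfolding noise_def by measurable

lemma measurable_bt[measurable]: "(\<lambda>v. bt v i) \<in> borel_measurable (leb d \<Otimes>\<^sub>M leb d)"
  unfolding bt_def by measurable

lemma measurable_log_odds[measurable]: "(\<lambda>v. log_odds v i) \<in> borel_measurable (leb d \<Otimes>\<^sub>M leb d)"
  unfolding log_odds_def by measurable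

lemma measurable_flip[measurable]: "flip J \<in> measurable (leb d \<Otimes>\<^sub>M leb d) (leb d \<Otimes>\<^sub>M leb d)"
  unfolding flip_def coef_def by (intro measurable_Pair measurable_restrict) auto

text \<open>The rows of [A | B] have Gram matrix \<Sigma> + (\<Delta> - \<Sigma>) = \<Delta>, which
  is diagonal. This is the source of the independence of the coordinates of
  \<open>bt\<close>.\<close>

lemma rows_orthogonal:
  assumes "i < d" "j < d"
  shows "(\<Sum>l<d. A i l * A j l) + (\<Sum>l<d. B i l * B j l) = (if i = j then \<delta> i else 0)"
  using AAT[rule_format, OF assms] BBT[rule_format, OF assms] by (simp add: mat_mult_transp_def diag_mat_def)

lemma noise_flip:
  assumes J: "J \<subseteq> {..<d}" and k: "k < d"
  shows "noise (flip J v) k = noise v k + (if k \<in> J then coef v k * \<delta> k else 0)"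
proof -
  have fin: "finite J" using J finite_subset by blast
  have "noise (flip J v) k = noise v k + ((\<Sum>i\<in>J. coef v i * (\<Sum>l<d. A k l * A i l)) + (\<Sum>i\<in>J. coef v i * (\<Sum>l<d. B k l * B i l)))"
    by (simp add: noise_def flip_def sum_mult_add_comb)
  also have "(\<Sum>i\<in>J. coef v i * (\<Sum>l<d. A k l * A i l)) + (\<Sum>i\<in>J. coef v i * (\<Sum>l<d. B k l * B i l))
      = (\<Sum>i\<in>J. coef v i * ((\<Sum>l<d. A k l * A i l) + (\<Sum>l<d. B k l * B i l)))"
    by (simp add: sum.distrib distrib_left)
  also have "\<dots> = (\<Sum>i\<in>J. if k = i then coef v k * \<delta> k else 0)"
    using J k by (intro sum.cong refl) (auto simp: rows_orthogonal subset_eq)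
  also have "\<dots> = (if k \<in> J then coef v k * \<delta> k else 0)" using fin by simp
  finally show ?thesis .
qed

lemma bt_flip:
  assumes "J \<subseteq> {..<d}" "k < d"
  shows "bt (flip J v) k = (if k \<in> J then - bt v k else bt v k)"
proof -
  have "\<sigma> * (coef v k * \<delta> k) = - 2 * bt v k"
    using sigma_pos delta_pos[OF assms(2)] by (simp add: coef_def)
  then show ?thesis unfolding bt_def[of "flip J v"] noise_flip[OF assms]
    by (simp add: distrib_left) (simp add: bt_def)
qed

text \<open>Flipping J leaves coordinate i of \<open>bt\<close>, and hence its coefficient,
  unchanged. Flips can therefore be treated one reflection at a time.\<close>

lemma flip_insert:
  assumes "i \<notin> J" "insert i J \<subseteq> {..<d}"
  shows "flip (insert i J) v = flip {i} (flip J v)"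
proof -
  have "finite (insert i J)" by (rule finite_subset[OF assms(2)]) simp
  then have "finite J" by simp
  moreover have coef: "coef (flip J v) i = coef v i" using assms by (simp add: coef_def bt_flip)
  moreover have single: "flip {i} w = (\<lambda>l\<in>{..<d}. fst w l + coef w i * A i l, \<lambda>l\<in>{..<d}. snd w l + coef w i * B i l)" for w
    by (simp add: flip_def)
  ultimately show ?thesis using assms(1) unfolding single coef by (auto simp: flip_def fun_eq_iff)
qed

lemma nn_integral_flip:
  assumes "J \<subseteq> {..<d}" and F: "F \<in> borel_measurable (leb d \<Otimes>\<^sub>M leb d)"
  shows "(\<integral>\<^sup>+v. F (flip J v) \<partial>(leb d \<Otimes>\<^sub>M leb d)) = (\<integral>\<^sup>+v. F v \<partial>(leb d \<Otimes>\<^sub>M leb d))"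
proof -
  have single: "(\<integral>\<^sup>+v. F (flip {i} v) \<partial>(leb d \<Otimes>\<^sub>M leb d)) = (\<integral>\<^sup>+v. F v \<partial>(leb d \<Otimes>\<^sub>M leb d))"
    if i: "i < d" and F: "F \<in> borel_measurable (leb d \<Otimes>\<^sub>M leb d)" for i and F :: "_ \<Rightarrow> ennreal"
  proof -
    \<comment> \<open>The reflection lemma needs a pivot in the z block. It exists because the
      squared norm of the row of A is the positive diagonal entry of S.\<close>
    have "\<exists>p<d. A i p \<noteq> 0"
    proof (rule ccontr)
      assume "\<not> ?thesis"
      then have "mat_mult_transp d A i i = 0" by (simp add: mat_mult_transp_def)
      then show False using AAT i pos_def_diag_pos[OF pos_def i] by simp
    qed
    then obtain p where p: "p < d" "A i p \<noteq> 0" by blast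
    have D: "(\<Sum>q<d. (A i q)\<^sup>2) + (\<Sum>q<d. (B i q)\<^sup>2) = \<delta> i"
      using rows_orthogonal[OF i i] by (simp add: power2_eq_square)
    have "\<beta> i / \<sigma> + (\<Sum>q<d. A i q * fst v q) + (\<Sum>q<d. B i q * snd v q) = bt v i / \<sigma>" for v
      using sigma_pos by (simp add: bt_def noise_def add_divide_distrib)
    then have "flip {i} v = (\<lambda>q\<in>{..<d}. fst v q - 2 * (\<beta> i / \<sigma> + (\<Sum>q<d. A i q * fst v q) + (\<Sum>q<d. B i q * snd v q)) / \<delta> i * A i q,
        \<lambda>q\<in>{..<d}. snd v q - 2 * (\<beta> i / \<sigma> + (\<Sum>q<d. A i q * fst v q) + (\<Sum>q<d. B i q * snd v q)) / \<delta> i * B i q)" for v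
      by (simp add: flip_def coef_def)
    then show ?thesis using nn_integral_reflection[where a="A i" and b="B i" and m="\<beta> i / \<sigma>" and F=F, OF p F] by (simp only: D)
  qed
  have "finite J" using assms(1) finite_subset by blast
  then show ?thesis using assms
  proof (induction J arbitrary: F rule: finite_induct)
    case empty
    show ?case
    proof (intro nn_integral_cong arg_cong[of _ _ F])
      fix v assume "v \<in> space (leb d \<Otimes>\<^sub>M leb d)"
      then show "flip {} v = v"
        by (cases v) (auto simp: flip_def space_pair_measure space_PiM PiE_def extensional_restrict)
    qed
  next
    case (insert i J)
    have "(\<integral>\<^sup>+v. F (flip (insert i J) v) \<partial>(leb d \<Otimes>\<^sub>M leb d)) = (\<integral>\<^sup>+v. F (flip {i} (flip J v)) \<partial>(leb d \<Otimes>\<^sub>M leb d))"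
      using flip_insert[OF insert.hyps(2) insert.prems(1)] by simp
    also have "\<dots> = (\<integral>\<^sup>+v. F (flip {i} v) \<partial>(leb d \<Otimes>\<^sub>M leb d))"
      using insert.prems(1) measurable_compose[OF measurable_flip insert.prems(2)]
      by (intro insert.IH[where F="\<lambda>v. F (flip {i} v)"]) auto
    also have "\<dots> = (\<integral>\<^sup>+v. F v \<partial>(leb d \<Otimes>\<^sub>M leb d))" using insert.prems by (intro single) auto
    finally show ?case .
  qed
qed

lemma gauss_density_flip_single:
  assumes i: "i < d"
  shows "gauss_density d (flip {i} v) = gauss_density d v * exp (- log_odds v i)"
proof -
  let ?k = "coef v i"
  have sq: "(\<Sum>l<d. (x l + c * a l)\<^sup>2) = (\<Sum>l<d. (x l)\<^sup>2) + 2 * c * (\<Sum>l<d. a l * x l) + c\<^sup>2 * (\<Sum>l<d. a l * a l)"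
    for x a :: "nat \<Rightarrow> real" and c
    by (simp add: power2_eq_square algebra_simps sum.distrib sum_distrib_left)
  have "(\<Sum>l<d. (fst (flip {i} v) l)\<^sup>2) + (\<Sum>l<d. (snd (flip {i} v) l)\<^sup>2)
      = (\<Sum>l<d. (fst v l)\<^sup>2) + (\<Sum>l<d. (snd v l)\<^sup>2) + (2 * ?k * noise v i + ?k\<^sup>2 * ((\<Sum>l<d. A i l * A i l) + (\<Sum>l<d. B i l * B i l)))"
    by (simp add: flip_def sq noise_def distrib_left)
  \<comment> \<open>The terms quadratic in \<open>bt\<close> cancel, leaving a change of the squared
    norm that is linear in it.\<close>
  also have "2 * ?k * noise v i + ?k\<^sup>2 * ((\<Sum>l<d. A i l * A i l) + (\<Sum>l<d. B i l * B i l)) = 2 * log_odds v i"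
  proof -
    have n: "noise v i = (bt v i - \<beta> i) / \<sigma>" using sigma_pos by (simp add: bt_def)
    show ?thesis unfolding rows_orthogonal[OF i i] n coef_def log_odds_def
      using sigma_pos delta_pos[OF i] by (simp add: field_simps power2_eq_square)
  qed
  finally have "(\<Sum>l<d. (fst (flip {i} v) l)\<^sup>2) + (\<Sum>l<d. (snd (flip {i} v) l)\<^sup>2)
      = (\<Sum>l<d. (fst v l)\<^sup>2) + (\<Sum>l<d. (snd v l)\<^sup>2) + 2 * log_odds v i" .
  then show ?thesis unfolding gauss_density_def
    by (simp add: exp_add[symmetric] diff_divide_distrib mult.assoc)
qed

lemma gauss_density_flip:
  assumes "J \<subseteq> {..<d}" "v \<in> space (leb d \<Otimes>\<^sub>M leb d)"
  shows "gauss_density d (flip J v) = gauss_density d v * (\<Prod>i\<in>J. exp (- log_odds v i))"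
proof -
  have "finite J" using assms(1) finite_subset by blast
  then show ?thesis using assms(1)
  proof (induction J rule: finite_induct)
    case empty
    have "flip {} v = v" using assms(2)
      by (cases v) (auto simp: flip_def space_pair_measure space_PiM PiE_def extensional_restrict)
    then show ?case by simp
  next
    case (insert i J)
    have i: "i < d" "J \<subseteq> {..<d}" using insert.prems by auto
    have "log_odds (flip J v) i = log_odds v i"
      using insert.hyps(2) i by (simp add: log_odds_def bt_flip)
    then show ?case
      unfolding flip_insert[OF insert.hyps(2) insert.prems] gauss_density_flip_single[OF i(1)] insert.IH[OF i(2)]
      using insert.hyps by simp
  qed
qed

section \<open>Invariance of the inputs of the rule under flips\<close>

definition bhat :: "(nat \<Rightarrow> real) \<times> (nat \<Rightarrow> real) \<Rightarrow> nat \<Rightarrow> real" where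
  "bhat v = (\<lambda>i\<in>{..<d}. \<beta> i + \<sigma> * (\<Sum>l<d. A i l * fst v l))"

definition xi :: "(nat \<Rightarrow> real) \<times> (nat \<Rightarrow> real) \<Rightarrow> nat \<Rightarrow> real" where
  "xi v = (\<lambda>i\<in>{..<d}. mat_inv_vec d S (bhat v) i - bt v i / \<delta> i)"

text \<open>A flip moves the estimate by S c with c supported on J, so its image under the inverse
  of S moves by c. The quotients \<open>bt v i / \<delta> i\<close> move by the same c, and the
  difference is unchanged.\<close>

lemma xi_flip:
  assumes "J \<subseteq> {..<d}"
  shows "xi (flip J v) = xi v"
proof -
  define c where "c i = (if i \<in> J then \<sigma> * coef v i else 0)" for i
  have "bhat (flip J v) i = bhat v i + (\<Sum>j<d. S i j * c j)" if i: "i < d" for i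
  proof -
    have "(\<Sum>l<d. A i l * fst (flip J v) l) = (\<Sum>l<d. A i l * fst v l) + (\<Sum>j\<in>J. coef v j * (\<Sum>l<d. A i l * A j l))"
      by (simp add: flip_def sum_mult_add_comb)
    also have "(\<Sum>j\<in>J. coef v j * (\<Sum>l<d. A i l * A j l)) = (\<Sum>j\<in>J. coef v j * S i j)"
      using AAT i assms by (intro sum.cong) (auto simp: mat_mult_transp_def subset_eq)
    finally have "bhat (flip J v) i = bhat v i + \<sigma> * (\<Sum>j\<in>J. coef v j * S i j)"
      using i by (simp add: bhat_def distrib_left)
    also have "\<sigma> * (\<Sum>j\<in>J. coef v j * S i j) = (\<Sum>j\<in>J. S i j * (\<sigma> * coef v j))"
      by (simp add: sum_distrib_left mult_ac)
    also have "(\<Sum>j\<in>J. S i j * (\<sigma> * coef v j)) = (\<Sum>j<d. S i j * c j)"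
      using assms by (intro sum.mono_neutral_cong_left) (auto simp: c_def)
    finally show ?thesis .
  qed
  then have inv: "mat_inv_vec d S (bhat (flip J v)) i = mat_inv_vec d S (bhat v) i + c i" if "i < d" for i
    by (rule mat_inv_vec_add[OF pos_def _ that])
  have "bt (flip J v) i / \<delta> i = bt v i / \<delta> i + c i" if i: "i < d" for i
    using delta_pos[OF i] sigma_pos by (simp add: bt_flip[OF assms i] c_def coef_def field_simps)
  with inv show ?thesis by (auto simp: xi_def fun_eq_iff)
qed

text \<open>The rule sees the same \<xi> and the same absolute values on the whole orbit, so
  ordering and signs stay fixed and only the signs of \<open>bt\<close> vary.\<close>

lemma knockoff_R_flip:
  assumes J: "J \<subseteq> {..<d}"
  shows "knockoff_R \<alpha> d S \<beta> \<sigma> \<delta> A B r (flip J v, a) =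
    (case r (xi v) (\<lambda>i\<in>{..<d}. \<bar>bt v i\<bar>) a of (perm, \<psi>) \<Rightarrow>
      n_rej \<alpha> d (\<lambda>i. if i \<in> J then - restrict (bt v) {..<d} i else restrict (bt v) {..<d} i) perm \<psi>)"
proof -
  have R: "knockoff_R \<alpha> d S \<beta> \<sigma> \<delta> A B r (v, a) =
    (case r (xi v) (\<lambda>i\<in>{..<d}. \<bar>bt v i\<bar>) a of (perm, \<psi>) \<Rightarrow> n_rej \<alpha> d (restrict (bt v) {..<d}) perm \<psi>)" for v
  proof -
    have b: "(\<lambda>i\<in>{..<d}. \<beta> i + \<sigma> * mat_vec d A (fst v) i) = bhat v"
      by (auto simp: bhat_def mat_vec_def)
    have t: "(\<lambda>i\<in>{..<d}. bhat v i + \<sigma> * mat_vec d B (snd v) i) = restrict (bt v) {..<d}"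
      by (auto simp: bhat_def mat_vec_def bt_def noise_def distrib_left)
    have x: "(\<lambda>i\<in>{..<d}. mat_inv_vec d S (bhat v) i - restrict (bt v) {..<d} i / \<delta> i) = xi v"
      by (auto simp: xi_def)
    have m: "(\<lambda>i\<in>{..<d}. \<bar>restrict (bt v) {..<d} i\<bar>) = (\<lambda>i\<in>{..<d}. \<bar>bt v i\<bar>)" by auto
    show ?thesis unfolding knockoff_R_def Let_def fst_conv snd_conv b t x m ..
  qed
  have "restrict (bt (flip J v)) {..<d} = (\<lambda>i. if i \<in> J then - restrict (bt v) {..<d} i else restrict (bt v) {..<d} i)"
    using J by (auto simp: fun_eq_iff restrict_def bt_flip[OF J])
  moreover have "(\<lambda>i\<in>{..<d}. \<bar>bt (flip J v) i\<bar>) = (\<lambda>i\<in>{..<d}. \<bar>bt v i\<bar>)"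
    by (auto simp: fun_eq_iff restrict_def bt_flip[OF J])
  ultimately show ?thesis by (simp add: R xi_flip[OF J])
qed

section \<open>Bad indices and the bound on the expected number of rejections\<close>

definition n_bad :: "real \<Rightarrow> (nat \<Rightarrow> real) \<times> (nat \<Rightarrow> real) \<Rightarrow> real" where
  "n_bad L v = (\<Sum>i<d. if L < \<bar>log_odds v i\<bar> then 1 else 0)"

lemma n_bad_nonneg: "0 \<le> n_bad L v"
  by (simp add: n_bad_def sum_nonneg)

lemma n_bad_flip:
  assumes "J \<subseteq> {..<d}"
  shows "n_bad L (flip J v) = n_bad L v"
proof -
  have "\<bar>log_odds (flip J v) i\<bar> = \<bar>log_odds v i\<bar>" if "i < d" for i
    by (simp add: log_odds_def bt_flip[OF assms that])
  then show ?thesis by (simp add: n_bad_def)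
qed

lemma measurable_n_bad[measurable]: "n_bad L \<in> borel_measurable (leb d \<Otimes>\<^sub>M leb d)"
  unfolding n_bad_def by measurable

text \<open>Averaging over the 2^d flips replaces conditioning. Flips preserve Lebesgue measure, so
  it suffices to compare density-weighted sums over each orbit, where
  \<open>flip_average_n_rej_le\<close> applies and the number of bad indices is constant.\<close>

lemma nn_integral_knockoff_R_le:
  fixes \<alpha> L \<theta> \<tau> q :: real
  assumes r: "valid_rule d r" and const: "0 \<le> \<theta>" "0 \<le> \<tau>" "0 \<le> \<alpha>" "0 < \<theta> - \<tau> * \<alpha>" "q < 1"
    and q: "q = (exp L * exp \<theta> + exp (- \<tau>)) / (1 + exp L)"
    and F: "(\<lambda>v. real (knockoff_R \<alpha> d S \<beta> \<sigma> \<delta> A B r (v, a))) \<in> borel_measurable (leb d \<Otimes>\<^sub>M leb d)"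
  shows "(\<integral>\<^sup>+v. real (knockoff_R \<alpha> d S \<beta> \<sigma> \<delta> A B r (v, a)) \<partial>(std_gauss d \<Otimes>\<^sub>M std_gauss d))
    \<le> (\<integral>\<^sup>+v. ennreal ((\<theta> * n_bad L v + 1 / (1 - q)) / (\<theta> - \<tau> * \<alpha>)) \<partial>(std_gauss d \<Otimes>\<^sub>M std_gauss d))"
proof -
  let ?N = "leb d \<Otimes>\<^sub>M leb d" and ?P = "Pow {..<d}"
  define R where "R v = real (knockoff_R \<alpha> d S \<beta> \<sigma> \<delta> A B r (v, a))" for v
  define H where "H v = (\<theta> * n_bad L v + 1 / (1 - q)) / (\<theta> - \<tau> * \<alpha>)" for v
  have [measurable]: "R \<in> borel_measurable ?N" using F by (simp add: R_def[abs_def])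
  have [measurable]: "H \<in> borel_measurable ?N" unfolding H_def by measurable
  have H0: "0 \<le> H v" for v using const n_bad_nonneg by (simp add: H_def)
  have R0: "0 \<le> R v" for v by (simp add: R_def)
  have orbit: "(\<Sum>J\<in>?P. gauss_density d (flip J v) * R (flip J v)) \<le> (\<Sum>J\<in>?P. gauss_density d (flip J v) * H (flip J v))"
    if v: "v \<in> space ?N" for v
  proof -
    obtain perm \<psi> where pp: "r (xi v) (\<lambda>i\<in>{..<d}. \<bar>bt v i\<bar>) a = (perm, \<psi>)" by fastforce
    have perm: "bij_betw perm {..<d} {..<d}" and psi: "\<And>i. i < d \<Longrightarrow> \<psi> i \<in> {-1, 1}"
      using r pp unfolding valid_rule_def by (metis fst_conv, metis snd_conv)
    define Bad where "Bad = {i. i < d \<and> L < \<bar>log_odds v i\<bar>}"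
    have Bad: "Bad \<subseteq> {..<d}" by (auto simp: Bad_def)
    have card: "real (card Bad) = n_bad L v"
    proof -
      have "{..<d} \<inter> {i. L < \<bar>log_odds v i\<bar>} = Bad" by (auto simp: Bad_def)
      then show ?thesis by (simp add: n_bad_def sum.If_cases)
    qed
    define e where "e i = exp (- log_odds v i)" for i
    have e: "0 < e i" for i by (simp add: e_def)
    \<comment> \<open>For an index that is not bad, e i lies between exp (-L) and exp L, which is
      the odds condition with c = exp L.\<close>
    have e': "e i \<le> exp L \<and> 1 \<le> exp L * e i" if "i < d" "i \<notin> Bad" for i
    proof -
      have "\<bar>log_odds v i\<bar> \<le> L" using that by (auto simp: Bad_def)
      then show ?thesis by (auto simp: e_def exp_add[symmetric])
    qed
    let ?n = "\<lambda>J. real (n_rej \<alpha> d (\<lambda>i. if i \<in> J then - restrict (bt v) {..<d} i else restrict (bt v) {..<d} i) perm \<psi>)"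
    have RJ: "R (flip J v) = ?n J" if "J \<in> ?P" for J
      using that by (simp add: R_def knockoff_R_flip pp)
    have main: "(\<Sum>J\<in>?P. (\<Prod>i\<in>J. e i) * ((\<theta> - \<tau> * \<alpha>) * ?n J)) \<le> (\<theta> * real (card Bad) + 1 / (1 - q)) * (\<Sum>J\<in>?P. \<Prod>i\<in>J. e i)"
      unfolding q by (rule flip_average_n_rej_le) (use perm psi const Bad e e' q in auto)
    have "(\<theta> - \<tau> * \<alpha>) * (\<Sum>J\<in>?P. (\<Prod>i\<in>J. e i) * ?n J) \<le> (\<theta> - \<tau> * \<alpha>) * (H v * (\<Sum>J\<in>?P. \<Prod>i\<in>J. e i))"
    proof -
      have "(\<theta> - \<tau> * \<alpha>) * H v = \<theta> * real (card Bad) + 1 / (1 - q)"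
        using const by (simp add: H_def card)
      then have "(\<theta> - \<tau> * \<alpha>) * (H v * (\<Sum>J\<in>?P. \<Prod>i\<in>J. e i)) = (\<theta> * real (card Bad) + 1 / (1 - q)) * (\<Sum>J\<in>?P. \<Prod>i\<in>J. e i)"
        by (simp only: mult.assoc[symmetric])
      with main show ?thesis by (simp add: sum_distrib_left mult.left_commute)
    qed
    then have "(\<Sum>J\<in>?P. (\<Prod>i\<in>J. e i) * ?n J) \<le> H v * (\<Sum>J\<in>?P. \<Prod>i\<in>J. e i)"
      using const(4) by (simp only: mult_le_cancel_left_pos)
    from mult_left_mono[OF this gauss_density_nonneg[of d v]]
    have "(\<Sum>J\<in>?P. gauss_density d v * (\<Prod>i\<in>J. e i) * ?n J) \<le> (\<Sum>J\<in>?P. gauss_density d v * (\<Prod>i\<in>J. e i) * H v)"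
      by (simp add: sum_distrib_left sum_distrib_right mult_ac)
    moreover have "(\<Sum>J\<in>?P. gauss_density d (flip J v) * R (flip J v)) = (\<Sum>J\<in>?P. gauss_density d v * (\<Prod>i\<in>J. e i) * ?n J)"
      by (intro sum.cong refl) (use v in \<open>simp add: RJ gauss_density_flip e_def\<close>)
    moreover have "(\<Sum>J\<in>?P. gauss_density d (flip J v) * H (flip J v)) = (\<Sum>J\<in>?P. gauss_density d v * (\<Prod>i\<in>J. e i) * H v)"
      by (intro sum.cong refl) (use v in \<open>simp add: H_def n_bad_flip gauss_density_flip e_def\<close>)
    ultimately show ?thesis by simp
  qed
  have symm: "of_nat (card ?P) * (\<integral>\<^sup>+v. ennreal (gauss_density d v * G v) \<partial>?N)
      = (\<integral>\<^sup>+v. ennreal (\<Sum>J\<in>?P. gauss_density d (flip J v) * G (flip J v)) \<partial>?N)"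
    if [measurable]: "G \<in> borel_measurable ?N" and G: "\<And>v. 0 \<le> G v" for G
  proof -
    have "(\<integral>\<^sup>+v. ennreal (\<Sum>J\<in>?P. gauss_density d (flip J v) * G (flip J v)) \<partial>?N)
        = (\<integral>\<^sup>+v. (\<Sum>J\<in>?P. ennreal (gauss_density d (flip J v) * G (flip J v))) \<partial>?N)"
      by (intro nn_integral_cong sum_ennreal[symmetric]) (simp add: G gauss_density_nonneg)
    also have "\<dots> = (\<Sum>J\<in>?P. \<integral>\<^sup>+v. ennreal (gauss_density d (flip J v) * G (flip J v)) \<partial>?N)"
      by (rule nn_integral_sum) measurable
    also have "\<dots> = (\<Sum>J\<in>?P. \<integral>\<^sup>+v. ennreal (gauss_density d v * G v) \<partial>?N)"
      by (intro sum.cong refl nn_integral_flip[where F="\<lambda>v. ennreal (gauss_density d v * G v)"]) auto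
    finally show ?thesis by simp
  qed
  have "of_nat (card ?P) * (\<integral>\<^sup>+v. ennreal (gauss_density d v * R v) \<partial>?N)
      \<le> of_nat (card ?P) * (\<integral>\<^sup>+v. ennreal (gauss_density d v * H v) \<partial>?N)"
    unfolding symm[OF \<open>R \<in> _\<close> R0] symm[OF \<open>H \<in> _\<close> H0]
    by (intro nn_integral_mono ennreal_leI orbit)
  then have le: "(\<integral>\<^sup>+v. ennreal (gauss_density d v * R v) \<partial>?N) \<le> (\<integral>\<^sup>+v. ennreal (gauss_density d v * H v) \<partial>?N)"
    by (subst (asm) ennreal_mult_le_mult_iff) (auto simp: card_Pow power_eq_top_ennreal)
  have dens: "(\<integral>\<^sup>+v. ennreal (G v) \<partial>(std_gauss d \<Otimes>\<^sub>M std_gauss d)) = (\<integral>\<^sup>+v. ennreal (gauss_density d v * G v) \<partial>?N)"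
    if [measurable]: "G \<in> borel_measurable ?N" and G: "\<And>v. 0 \<le> G v" for G
    unfolding std_gauss_pair_eq_density
    by (subst nn_integral_density) (auto simp: ennreal_mult G gauss_density_nonneg)
  have "(\<integral>\<^sup>+v. ennreal (R v) \<partial>(std_gauss d \<Otimes>\<^sub>M std_gauss d)) \<le> (\<integral>\<^sup>+v. ennreal (H v) \<partial>(std_gauss d \<Otimes>\<^sub>M std_gauss d))"
    using le by (simp only: dens[OF \<open>R \<in> _\<close> R0] dens[OF \<open>H \<in> _\<close> H0])
  then show ?thesis by (simp only: R_def H_def)
qed

text \<open>The log odds are a mean of at most L \<rho>, with \<rho> = b / \<delta>, plus a Gaussian
  term. If \<rho> <= 1/2 that term must exceed L/2, and Markov's inequality for the fourth power
  gives order \<rho>^2; otherwise 4 \<rho>^2 >= 1. A second moment would give only order \<rho>,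
  whose sum can carry a logarithm of d/k.\<close>

lemma prob_large_log_odds_le:
  fixes L b \<beta>2 :: real
  assumes i: "i < d" and L: "0 < L" and b: "0 < b" and \<beta>2: "(\<beta> i)\<^sup>2 \<le> \<beta>2" "2 * \<beta>2 / (\<sigma>\<^sup>2 * b) < L"
  shows "(\<integral>\<^sup>+v. ennreal (if L < \<bar>log_odds v i\<bar> then 1 else 0) \<partial>(std_gauss d \<Otimes>\<^sub>M std_gauss d))
    \<le> ennreal ((4 + 64 * (512 * exp (1/2)) / L\<^sup>2) * (b / \<delta> i)\<^sup>2)"
proof -
  let ?M = "std_gauss d \<Otimes>\<^sub>M std_gauss d"
  define \<rho> where "\<rho> = b / \<delta> i"
  define M where "M = 512 * exp (1/2 :: real)"
  note dpos = delta_pos[OF i]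
  have \<rho>0: "0 < \<rho>" using dpos b by (simp add: \<rho>_def)
  have D: "(\<Sum>q<d. (A i q)\<^sup>2) + (\<Sum>q<d. (B i q)\<^sup>2) = \<delta> i"
    using rows_orthogonal[OF i i] by (simp add: power2_eq_square)
  have fourth: "(\<integral>\<^sup>+v. ennreal (noise v i ^ 4) \<partial>?M) \<le> ennreal (M * (\<delta> i)\<^sup>2)"
    using nn_integral_power4_std_gauss_pair[where d=d and a="A i" and b="B i"] dpos unfolding D by (simp add: noise_def M_def)
  have b1: "2 * (\<beta> i)\<^sup>2 / (\<sigma>\<^sup>2 * \<delta> i) \<le> L * \<rho>"
  proof -
    have "2 * (\<beta> i)\<^sup>2 / (\<sigma>\<^sup>2 * \<delta> i) \<le> 2 * \<beta>2 / (\<sigma>\<^sup>2 * \<delta> i)"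
      using \<beta>2 sigma_pos dpos by (intro divide_right_mono) auto
    also have "\<dots> = 2 * \<beta>2 / (\<sigma>\<^sup>2 * b) * \<rho>" using b by (simp add: \<rho>_def)
    also have "\<dots> \<le> L * \<rho>" using \<beta>2 \<rho>0 by (intro mult_right_mono) auto
    finally show ?thesis .
  qed
  have pt: "(if L < \<bar>log_odds v i\<bar> then 1 else 0) \<le> 4 * \<rho>\<^sup>2 + 64 * \<rho>\<^sup>2 / (L\<^sup>2 * (\<delta> i)\<^sup>2) * noise v i ^ 4" for v
  proof (cases "L < \<bar>log_odds v i\<bar> \<and> \<rho> \<le> 1/2")
    case True
    define y where "y = 2 * \<bar>\<beta> i\<bar> * \<bar>noise v i\<bar> / (\<sigma> * \<delta> i)"
    have "log_odds v i = 2 * (\<beta> i)\<^sup>2 / (\<sigma>\<^sup>2 * \<delta> i) + 2 * \<beta> i * noise v i / (\<sigma> * \<delta> i)"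
      using sigma_pos dpos by (simp add: log_odds_def bt_def power2_eq_square field_simps)
    then have "\<bar>log_odds v i\<bar> \<le> \<bar>2 * (\<beta> i)\<^sup>2 / (\<sigma>\<^sup>2 * \<delta> i)\<bar> + \<bar>2 * \<beta> i * noise v i / (\<sigma> * \<delta> i)\<bar>"
      by (simp only: abs_triangle_ineq)
    also have "\<dots> = 2 * (\<beta> i)\<^sup>2 / (\<sigma>\<^sup>2 * \<delta> i) + y"
      using sigma_pos dpos by (simp add: y_def abs_mult abs_divide)
    finally have "L < L * \<rho> + y" using True b1 by linarith
    moreover have "L * \<rho> \<le> L * (1/2)" using True L by (intro mult_left_mono) auto
    ultimately have "L / 2 \<le> y" by linarith
    then have "(L / 2)\<^sup>2 \<le> y\<^sup>2" using L by (intro power_mono) auto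
    \<comment> \<open>One factor is the mean of the log odds, at most L \<rho>; the other is the
      squared noise in units of its variance. Squaring once more produces \<rho>^2 and the fourth
      power of the noise.\<close>
    also have "y\<^sup>2 = 2 * (\<beta> i)\<^sup>2 / (\<sigma>\<^sup>2 * \<delta> i) * (2 * (noise v i)\<^sup>2 / \<delta> i)"
      by (simp add: y_def power_divide power_mult_distrib) (simp add: power2_eq_square)
    also have "\<dots> \<le> L * \<rho> * (2 * (noise v i)\<^sup>2 / \<delta> i)"
      using b1 dpos by (intro mult_right_mono) auto
    finally have "1 \<le> 8 * \<rho> * (noise v i)\<^sup>2 / (L * \<delta> i)"
      using L dpos by (simp add: field_simps power2_eq_square)
    then have "1 \<le> (8 * \<rho> * (noise v i)\<^sup>2 / (L * \<delta> i))\<^sup>2" by simp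
    also have "\<dots> = 64 * \<rho>\<^sup>2 / (L\<^sup>2 * (\<delta> i)\<^sup>2) * noise v i ^ 4"
      by (simp add: power_divide power_mult_distrib flip: power_mult)
    finally show ?thesis using True by (simp add: add_increasing)
  next
    case False
    have nn: "0 \<le> 64 * \<rho>\<^sup>2 / (L\<^sup>2 * (\<delta> i)\<^sup>2) * noise v i ^ 4" by (simp add: zero_le_even_power)
    show ?thesis
    proof (cases "\<rho> \<le> 1/2")
      case True
      with False nn show ?thesis by simp
    next
      case False
      then have "(1/2)\<^sup>2 \<le> \<rho>\<^sup>2" by (intro power_mono) auto
      then have "1 \<le> 4 * \<rho>\<^sup>2" by (simp add: power2_eq_square)
      with nn show ?thesis by (simp add: add_increasing2)
    qed
  qed
  interpret P: pair_prob_space "std_gauss d" "std_gauss d"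
    by (intro pair_prob_space.intro pair_sigma_finite.intro prob_space_imp_sigma_finite prob_space_std_gauss)
  have [measurable]: "(\<lambda>v. noise v i) \<in> borel_measurable ?M" unfolding noise_def by measurable
  have "(\<integral>\<^sup>+v. ennreal (if L < \<bar>log_odds v i\<bar> then 1 else 0) \<partial>?M)
      \<le> (\<integral>\<^sup>+v. ennreal (4 * \<rho>\<^sup>2) + ennreal (64 * \<rho>\<^sup>2 / (L\<^sup>2 * (\<delta> i)\<^sup>2)) * ennreal (noise v i ^ 4) \<partial>?M)"
    by (intro nn_integral_mono) (use pt in \<open>simp add: ennreal_mult'[symmetric] ennreal_plus[symmetric] zero_le_even_power del: ennreal_plus\<close>)
  also have "\<dots> = ennreal (4 * \<rho>\<^sup>2) + ennreal (64 * \<rho>\<^sup>2 / (L\<^sup>2 * (\<delta> i)\<^sup>2)) * (\<integral>\<^sup>+v. ennreal (noise v i ^ 4) \<partial>?M)"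
    by (subst nn_integral_add) (auto simp: nn_integral_cmult P.emeasure_space_1)
  also have "\<dots> \<le> ennreal (4 * \<rho>\<^sup>2) + ennreal (64 * \<rho>\<^sup>2 / (L\<^sup>2 * (\<delta> i)\<^sup>2)) * ennreal (M * (\<delta> i)\<^sup>2)"
    by (intro add_left_mono mult_left_mono fourth) simp
  also have "\<dots> = ennreal (4 * \<rho>\<^sup>2 + 64 * \<rho>\<^sup>2 / (L\<^sup>2 * (\<delta> i)\<^sup>2) * (M * (\<delta> i)\<^sup>2))"
    by (simp add: ennreal_mult[symmetric] ennreal_plus[symmetric] M_def del: ennreal_plus)
  also have "4 * \<rho>\<^sup>2 + 64 * \<rho>\<^sup>2 / (L\<^sup>2 * (\<delta> i)\<^sup>2) * (M * (\<delta> i)\<^sup>2) = (4 + 64 * M / L\<^sup>2) * \<rho>\<^sup>2"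
    using dpos L by (simp add: field_simps)
  finally show ?thesis by (simp add: \<rho>_def M_def)
qed

text \<open>The fewer than k indices with a square above the k-th largest cost at most 1 each. The
  others cost C min 1 (\<rho>^2), and these sum to at most 2 C k by the lower bounds on the diagonal
  of \<Delta>.\<close>

lemma nn_integral_n_bad_le:
  fixes L :: real
  assumes L: "0 < L" and eig: "eigen_decomp d S lam u" and k: "1 \<le> k" "k \<le> d"
    and b: "0 < b_k d lam u k" and strength: "2 * beta_sq_desc d \<beta> k / (\<sigma>\<^sup>2 * b_k d lam u k) < L"
  shows "(\<integral>\<^sup>+v. ennreal (n_bad L v) \<partial>(std_gauss d \<Otimes>\<^sub>M std_gauss d))
    \<le> ennreal ((1 + 2 * (4 + 64 * (512 * exp (1/2)) / L\<^sup>2)) * real k)"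
proof -
  let ?M = "std_gauss d \<Otimes>\<^sub>M std_gauss d"
  define C where "C = 4 + 64 * (512 * exp (1/2)) / L\<^sup>2"
  have C: "1 \<le> C" by (simp add: C_def add_increasing2)
  define \<rho> where "\<rho> i = b_k d lam u k / \<delta> i" for i
  define B0 where "B0 = {i. i < d \<and> beta_sq_desc d \<beta> k < (\<beta> i)\<^sup>2}"
  interpret P: pair_prob_space "std_gauss d" "std_gauss d"
    by (intro pair_prob_space.intro pair_sigma_finite.intro prob_space_imp_sigma_finite prob_space_std_gauss)
  have [measurable]: "(\<lambda>v. log_odds v i) \<in> borel_measurable ?M" for i
    unfolding log_odds_def bt_def noise_def by measurable
  have bad_i: "(\<integral>\<^sup>+v. ennreal (if L < \<bar>log_odds v i\<bar> then 1 else 0) \<partial>?M)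
      \<le> ennreal ((if i \<in> B0 then 1 else 0) + C * min 1 ((\<rho> i)\<^sup>2))" if i: "i < d" for i
  proof -
    have "(\<integral>\<^sup>+v. ennreal (if L < \<bar>log_odds v i\<bar> then 1 else 0) \<partial>?M) \<le> (\<integral>\<^sup>+v. 1 \<partial>?M)"
      by (intro nn_integral_mono) auto
    then have one: "(\<integral>\<^sup>+v. ennreal (if L < \<bar>log_odds v i\<bar> then 1 else 0) \<partial>?M) \<le> ennreal 1"
      by (simp add: P.emeasure_space_1)
    show ?thesis
    proof (cases "i \<in> B0 \<or> 1 \<le> (\<rho> i)\<^sup>2")
      case True
      \<comment> \<open>If \<rho>^2 >= 1 the minimum is 1, and C >= 1 covers the trivial probability
        bound.\<close>
      have "1 \<le> (if i \<in> B0 then 1 else 0) + C * min 1 ((\<rho> i)\<^sup>2)"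
        using True C by (auto simp: min_def)
      then show ?thesis using one by (meson ennreal_leI order_trans)
    next
      case False
      then have "(\<beta> i)\<^sup>2 \<le> beta_sq_desc d \<beta> k" using i by (auto simp: B0_def)
      from prob_large_log_odds_le[OF i L b this strength] False show ?thesis
        by (simp add: C_def \<rho>_def min_def)
    qed
  qed
  have small: "\<exists>i\<in>K. \<rho> i \<le> real k / real (card K)" if K: "K \<subseteq> {..<d}" "k \<le> card K" for K
  proof -
    obtain i where i: "i \<in> K" "real (card K) * b_k d lam u k \<le> real k * \<delta> i"
      using exists_large_diag[OF pos_def eig loewner k(1) b K] by blast
    have "0 < \<delta> i" "0 < real (card K)" using i K k delta_pos by auto
    with i show ?thesis by (intro bexI[of _ i]) (auto simp: \<rho>_def field_simps)
  qed
  have rho: "(\<Sum>i<d. min 1 ((\<rho> i)\<^sup>2)) \<le> 2 * real k"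
    by (rule sum_min_squares_le) (use k small b delta_pos in \<open>auto simp: \<rho>_def intro!: divide_nonneg_pos\<close>)
  have "(\<integral>\<^sup>+v. ennreal (n_bad L v) \<partial>?M)
      = (\<integral>\<^sup>+v. (\<Sum>i<d. ennreal (if L < \<bar>log_odds v i\<bar> then 1 else 0)) \<partial>?M)"
    unfolding n_bad_def by (intro nn_integral_cong sum_ennreal[symmetric]) auto
  also have "\<dots> = (\<Sum>i<d. \<integral>\<^sup>+v. ennreal (if L < \<bar>log_odds v i\<bar> then 1 else 0) \<partial>?M)"
    by (rule nn_integral_sum) measurable
  also have "\<dots> \<le> (\<Sum>i<d. ennreal ((if i \<in> B0 then 1 else 0) + C * min 1 ((\<rho> i)\<^sup>2)))"
    by (intro sum_mono bad_i) auto
  also have "\<dots> = ennreal (\<Sum>i<d. (if i \<in> B0 then 1 else 0) + C * min 1 ((\<rho> i)\<^sup>2))"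
    by (rule sum_ennreal) (use C in auto)
  also have "\<dots> \<le> ennreal ((1 + 2 * C) * real k)"
  proof (rule ennreal_leI)
    have "(\<Sum>i<d. (if i \<in> B0 then 1 else 0) + C * min 1 ((\<rho> i)\<^sup>2)) = real (card B0) + C * (\<Sum>i<d. min 1 ((\<rho> i)\<^sup>2))"
    proof -
      have "{..<d} \<inter> {i. i \<in> B0} = B0" by (auto simp: B0_def)
      then show ?thesis by (simp add: sum.distrib sum.If_cases sum_distrib_left)
    qed
    also have "\<dots> \<le> real k + C * (2 * real k)"
      using card_beta_sq_gt[OF k, of \<beta>] rho C unfolding B0_def by (intro add_mono mult_left_mono) auto
    finally show "(\<Sum>i<d. (if i \<in> B0 then 1 else 0) + C * min 1 ((\<rho> i)\<^sup>2)) \<le> (1 + 2 * C) * real k"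
      by (simp add: algebra_simps)
  qed
  finally show ?thesis by (simp add: C_def)
qed

end

section \<open>Choice of constants and integration over the auxiliary randomness\<close>

theorem theorem2:
  fixes \<alpha> :: real
  assumes "0 < \<alpha>" and "\<alpha> < 1"
  shows "\<exists>C1 C2 :: real. \<forall>(d::nat) S \<beta> (\<sigma>::real) lam u (k::nat) \<delta> A B (r::rule).
     pos_def d S \<and> 0 < \<sigma> \<and>
     eigen_decomp d S lam u \<and>
     k \<in> {1..d} \<and> strength_cond \<alpha> d \<beta> (\<sigma>\<^sup>2) lam u k \<and>
     (\<forall>j\<in>{1..<k}. \<not> strength_cond \<alpha> d \<beta> (\<sigma>\<^sup>2) lam u j) \<and>
     loewner_ge d (diag_mat \<delta>) S \<and>
     (\<forall>i<d. \<forall>j<d. mat_mult_transp d A i j = S i j) \<and>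
     (\<forall>i<d. \<forall>j<d. mat_mult_transp d B i j = diag_mat \<delta> i j - S i j) \<and>
     valid_rule d r
     \<longrightarrow> (\<integral>s. real (knockoff_R \<alpha> d S \<beta> \<sigma> \<delta> A B r s) \<partial>knock_space d) \<le> C1 * real k + C2"
proof -
  \<comment> \<open>The threshold of the signal condition, reused as the threshold for a bad index.
    Good signs then have odds at most exp L = \<alpha> powr (-1/2), the case covered by
    \<open>walk_constants\<close>.\<close>
  define L where "L = - (1/2) * ln \<alpha>"
  have L: "0 < L" using assms by (simp add: L_def)
  have expL: "exp L = \<alpha> powr (-1/2)" using assms by (simp add: L_def powr_def)
  obtain \<theta> \<tau> where const: "0 < \<theta>" "0 < \<tau>" "0 < \<theta> - \<tau> * \<alpha>" "(exp L * exp \<theta> + exp (- \<tau>)) / (1 + exp L) < 1"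
    using walk_constants[OF assms] unfolding expL by blast
  define q where "q = (exp L * exp \<theta> + exp (- \<tau>)) / (1 + exp L)"
  define C where "C = 1 + 2 * (4 + 64 * (512 * exp (1/2)) / L\<^sup>2)"
  define C1 where "C1 = \<theta> * C / (\<theta> - \<tau> * \<alpha>)"
  define C2 where "C2 = 1 / (1 - q) / (\<theta> - \<tau> * \<alpha>)"
  have q: "q < 1" using const by (simp add: q_def)
  have C: "0 \<le> C" by (simp add: C_def)
  have nonneg: "0 \<le> C1" "0 \<le> C2" using const q C by (simp_all add: C1_def C2_def)
  have "(\<integral>s. real (knockoff_R \<alpha> d S \<beta> \<sigma> \<delta> A B r s) \<partial>knock_space d) \<le> C1 * real k + C2"
    if H: "pos_def d S" "0 < \<sigma>" "eigen_decomp d S lam u" "k \<in> {1..d}" "strength_cond \<alpha> d \<beta> (\<sigma>\<^sup>2) lam u k"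
      "loewner_ge d (diag_mat \<delta>) S" "\<forall>i<d. \<forall>j<d. mat_mult_transp d A i j = S i j"
      "\<forall>i<d. \<forall>j<d. mat_mult_transp d B i j = diag_mat \<delta> i j - S i j" "valid_rule d r"
    for d S \<beta> \<sigma> lam u k \<delta> A B and r :: rule
  proof (cases "integrable (knock_space d) (\<lambda>s. real (knockoff_R \<alpha> d S \<beta> \<sigma> \<delta> A B r s))")
    \<comment> \<open>The Bochner integral of a non-integrable function is 0, and both constants are
      nonnegative.\<close>
    case False
    then show ?thesis using nonneg by (simp add: not_integrable_integral_eq)
  next
    case True
    interpret whitening d S \<beta> \<sigma> \<delta> A B by unfold_locales (fact H)+
    let ?G = "std_gauss d \<Otimes>\<^sub>M std_gauss d" and ?U = "uniform_measure lborel {0..1::real}"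
    let ?R = "\<lambda>s. real (knockoff_R \<alpha> d S \<beta> \<sigma> \<delta> A B r s)"
    interpret G: pair_prob_space "std_gauss d" "std_gauss d"
      by (intro pair_prob_space.intro pair_sigma_finite.intro prob_space_imp_sigma_finite prob_space_std_gauss)
    interpret U: prob_space ?U by (rule prob_space_uniform_measure) auto
    interpret GU: pair_sigma_finite ?G ?U
      by (intro pair_sigma_finite.intro G.sigma_finite_measure_axioms U.sigma_finite_measure_axioms)
    \<comment> \<open>Measurability of the count comes from integrability, since no measurability of
      the rule is assumed.\<close>
    have meas: "?R \<in> borel_measurable (?G \<Otimes>\<^sub>M ?U)"
      using borel_measurable_integrable[OF True] by (simp add: knock_space_def)
    have b: "0 < b_k d lam u k" and strength: "2 * beta_sq_desc d \<beta> k / (\<sigma>\<^sup>2 * b_k d lam u k) < L"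
      using H(2,5) by (auto simp: strength_cond_def L_def zero_less_mult_iff)
    \<comment> \<open>The bound holds for each fixed value a of the auxiliary variable, so Tonelli's
      theorem allows it to be averaged over a.\<close>
    have sec: "(\<integral>\<^sup>+v. ?R (v, a) \<partial>?G) \<le> ennreal (C1 * real k + C2)" for a
    proof -
      have "(\<lambda>v. ?R (v, a)) \<in> borel_measurable ?G"
        by (rule measurable_compose[OF _ meas]) (auto intro!: measurable_Pair)
      moreover have "sets ?G = sets (leb d \<Otimes>\<^sub>M leb d)"
        by (intro sets_pair_measure_cong sets_std_gauss)
      ultimately have "(\<lambda>v. ?R (v, a)) \<in> borel_measurable (leb d \<Otimes>\<^sub>M leb d)"
        by (simp cong: measurable_cong_sets)
      then have "(\<integral>\<^sup>+v. ?R (v, a) \<partial>?G) \<le> (\<integral>\<^sup>+v. ennreal ((\<theta> * n_bad L v + 1 / (1 - q)) / (\<theta> - \<tau> * \<alpha>)) \<partial>?G)"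
        using const assms q q_def by (intro nn_integral_knockoff_R_le H(9)) auto
      also have "\<dots> = (\<integral>\<^sup>+v. ennreal (\<theta> / (\<theta> - \<tau> * \<alpha>)) * ennreal (n_bad L v) + ennreal C2 \<partial>?G)"
      proof (intro nn_integral_cong)
        fix v
        have "(\<theta> * n_bad L v + 1 / (1 - q)) / (\<theta> - \<tau> * \<alpha>) = \<theta> / (\<theta> - \<tau> * \<alpha>) * n_bad L v + C2"
          by (simp add: C2_def add_divide_distrib)
        moreover have "0 \<le> \<theta> / (\<theta> - \<tau> * \<alpha>)" using const by simp
        ultimately show "ennreal ((\<theta> * n_bad L v + 1 / (1 - q)) / (\<theta> - \<tau> * \<alpha>)) = ennreal (\<theta> / (\<theta> - \<tau> * \<alpha>)) * ennreal (n_bad L v) + ennreal C2"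
          using nonneg n_bad_nonneg[of L v] by (metis ennreal_mult ennreal_plus mult_nonneg_nonneg)
      qed
      also have "\<dots> = ennreal (\<theta> / (\<theta> - \<tau> * \<alpha>)) * (\<integral>\<^sup>+v. ennreal (n_bad L v) \<partial>?G) + ennreal C2"
      proof -
        have [measurable]: "n_bad L \<in> borel_measurable ?G"
          unfolding n_bad_def log_odds_def bt_def noise_def by measurable
        show ?thesis by (subst nn_integral_add) (auto simp: nn_integral_cmult G.emeasure_space_1)
      qed
      also have "\<dots> \<le> ennreal (\<theta> / (\<theta> - \<tau> * \<alpha>)) * ennreal (C * real k) + ennreal C2"
        unfolding C_def using H(4)
        by (intro add_right_mono mult_left_mono nn_integral_n_bad_le[OF L H(3) _ _ b strength]) auto
      also have "\<dots> = ennreal (C1 * real k + C2)"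
        using const C nonneg by (simp add: C1_def ennreal_mult[symmetric] ennreal_plus[symmetric] mult_ac del: ennreal_plus)
      finally show ?thesis .
    qed
    have "ennreal (\<integral>s. ?R s \<partial>knock_space d) = (\<integral>\<^sup>+s. ?R s \<partial>(?G \<Otimes>\<^sub>M ?U))"
      using nn_integral_eq_integral[OF True] by (simp add: knock_space_def)
    also have "\<dots> = (\<integral>\<^sup>+a. \<integral>\<^sup>+v. ?R (v, a) \<partial>?G \<partial>?U)"
      by (rule GU.nn_integral_snd[symmetric]) (use meas in measurable)
    also have "\<dots> \<le> (\<integral>\<^sup>+a. ennreal (C1 * real k + C2) \<partial>?U)"
      by (intro nn_integral_mono sec)
    also have "\<dots> = ennreal (C1 * real k + C2)" by (simp add: U.emeasure_space_1)
    finally show ?thesis using nonneg by (subst (asm) ennreal_le_iff) auto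
  qed
  then show ?thesis by (intro exI[of _ C1] exI[of _ C2]) blast
qed

end
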